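(* Let $V$ be a $k$-dimensional complex inner product space, let $n\ge2$, let $p$ be a prime, and let $G=SD_{8n}\le S_{4n}$, where $4n=lp^t$ with $l$ an integer not divisible by $p$. Let $h\in\Pi$ be even and let $\phi=\hat\psi_h$ (if $n$ is even) or $\phi=\hat\psi'_h$ (if $n$ is odd). Then $V_\phi(G)$ has an o-basis if and only if $\nu_2\!\left(\frac{2h}{l}\right)<0$. Also, for each $\gamma\in\Delta$ and each $\sigma\in C$, $e^\phi_{\gamma\sigma}\ne0$ if and only if $\frac{ht_\gamma}{l}\in\mathbb{Z}$.
   Context: The semi-dihedral group is $SD_{8n}=\langle a,b\mid a^{4n}=b^2=e,\ bab=a^{2n-1}\rangle=\{a^i,ba^i:0\le i<4n\}$, embedded in $S_{4n}$ by $a\mapsto(u\mapsto\overline{u+1})$ and $b\mapsto(u\mapsto\overline{(2n-1)u})$, where $\overline{x}$ denotes the remainder of $x$ modulo $4n$ (residue $0$ identified with the point $4n$). $\nu_2$ is the 2-adic valuation on $\mathbb{Q}$. For an even integer $h$ with $0<h<2n$, the two-dimensional irreducible character of $SD_{8n}$ denoted $\psi_h$ ($n$ even), resp. $\psi'_h$ ($n$ odd), takes the value $2\cos(hr\pi/2n)$ at $a^r$ and vanishes at all $ba^r$. $\hat G$ is the set of $p$-regular elements of $G$ (those whose order is not divisible by $p$), and $\hat\psi_h=\psi_h|_{\hat G}$, $\hat\psi'_h=\psi'_h|_{\hat G}$. Index set: for $p\ne2$, put $E=\{2,4,\dots,\frac l2-2\}$, $O_1^\epsilon=\{1,3,5,\dots,\frac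 l4-\epsilon\}$, $O_2^\epsilon=\{\frac l2+1,\frac l2+3,\dots,\frac l2+\frac l4-\epsilon\}$, with $\epsilon=1$ if $n$ is even and $\epsilon=2$ if $n$ is odd, and $\Pi=\{jp^t: j\in E\cup O_1^\epsilon\cup O_2^\epsilon\}$; for $p=2$, $\Pi=\{jp^t:1\le j\le\frac{l-1}2\}$. $C=\langle a^{p^t}\rangle$ (cyclic of order $l$). Symmetry classes: with $m=4n$, let $\{e_1,\dots,e_k\}$ be an orthonormal basis of $V$; $\Gamma^m_k$ is the set of sequences $\alpha=(\alpha_1,\dots,\alpha_m)$ with $1\le\alpha_i\le k$; $\alpha\sigma=(\alpha_{\sigma(1)},\dots,\alpha_{\sigma(m)})$ for $\sigma\in G$; $G_\alpha=\{\sigma\in G:\alpha\sigma=\alpha\}$; $\Delta$ is a set of representatives of the $G$-orbits on $\Gamma^m_k$; $t_\gamma=l/|C\cap G_\gamma|$. Put $e_\alpha=e_{\alpha_1}\otimes\cdots\otimes e_{\alpha_m}$; $V^{\otimes m}$ has the induced inner product, for which the $e_\alpha$ are orthonormal. With $S=\hat G$ and $e$ the identity of $G$, $$e^\phi_\alpha=\frac{\phi(e)}{|S|}\sum_{\sigma\in S}\phi(\sigma)e_{\alpha\sigma^{-1}},\qquad V_\phi(G)=\operatorname{span}\{e^\phi_\alpha:\alpha\in\Gamma^m_k\}.$$ An o-basis of a subspace $W\subseteq V_\phi(G)$ is an orthogonal basis of $W$ of the form $\{e^\phi_{\alpha_1},\dots,e^\phi_{\alpha_q}\}$ with $\alpha_i\in\Gamma^m_k$;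 by convention the empty set is an o-basis of the zero subspace.
   Formalization: The o-basis equivalence is stated for k ≥ 2: for k ≤ 1 the space V_φ(G) is zero and has the empty o-basis whatever ν₂(2h/l) is, so the equivalence fails (e.g. k=1, n=3, p=2, l=3, h=4). The second claim is stated for every k. *)

theory Defs
  imports
    Complex_Main
    "HOL-Algebra.Sym_Groups"
    "HOL-Algebra.Multiplicative_Group"
    "HOL-Computational_Algebra.Primes"
    "HOL-Library.FuncSet"
    "HOL-Library.Poly_Mapping"
begin

section \<open>Complex inner product spaces and tensor powers\<close>

text \<open>The inner product is linear in its first argument. The space is the whole type.\<close>

locale complex_inner_space = vector_space scale
  for scale :: "complex \<Rightarrow> 'v::ab_group_add \<Rightarrow> 'v" +
  fixes ip :: "'v \<Rightarrow> 'v \<Rightarrow> complex"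
  assumes ip_add_left: "ip (x + y) z = ip x z + ip y z"
    and ip_scale_left: "ip (scale c x) y = c * ip x y"
    and ip_commute: "ip x y = cnj (ip y x)"
    and ip_pos: "x \<noteq> 0 \<Longrightarrow> Re (ip x x) > 0"

definition orthonormal_basis ::
    "(complex \<Rightarrow> 'v::ab_group_add \<Rightarrow> 'v) \<Rightarrow> ('v \<Rightarrow> 'v \<Rightarrow> complex) \<Rightarrow> nat \<Rightarrow> (nat \<Rightarrow> 'v) \<Rightarrow> bool" where
  "orthonormal_basis scale ip k e \<longleftrightarrow>
     (\<forall>i\<in>{1..k}. \<forall>j\<in>{1..k}. ip (e i) (e j) = (if i = j then 1 else 0)) \<and>
     module.span scale (e ` {1..k}) = UNIV"

text \<open>
  A model of the \<open>m\<close>-th tensor power of an inner product space \<open>V\<close> with the induced inner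
  product: \<open>tens x\<close> is the decomposable tensor of \<open>x 1, \<dots>, x m\<close>, and the tensor power itself is
  the linear span of all decomposable tensors inside \<open>W\<close>. Multilinearity together with the
  product formula for the inner product determines this span up to a unique isometry that
  respects decomposable tensors. \<open>W\<close> may be larger than the tensor power; all vectors
  considered below lie in the span of the decomposable tensors. A model always exists, see
  \<open>tensor_power_exists\<close> below.
\<close>

locale tensor_power =
  V: complex_inner_space scaleV ipV + W: complex_inner_space scaleW ipW
  for m :: nat
    and scaleV :: "complex \<Rightarrow> 'v::ab_group_add \<Rightarrow> 'v" and ipV :: "'v \<Rightarrow> 'v \<Rightarrow> complex"
    and scaleW :: "complex \<Rightarrow> 'w::ab_group_add \<Rightarrow> 'w" and ipW :: "'w \<Rightarrow> 'w \<Rightarrow> complex" +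
  fixes tens :: "(nat \<Rightarrow> 'v) \<Rightarrow> 'w"
  assumes tens_cong: "(\<And>i. i \<in> {1..m} \<Longrightarrow> x i = y i) \<Longrightarrow> tens x = tens y"
    and tens_add: "i \<in> {1..m} \<Longrightarrow> tens (x(i := u + v)) = tens (x(i := u)) + tens (x(i := v))"
    and tens_scale: "i \<in> {1..m} \<Longrightarrow> tens (x(i := scaleV c u)) = scaleW c (tens (x(i := u)))"
    and ip_tens: "ipW (tens x) (tens y) = (\<Prod>i\<in>{1..m}. ipV (x i) (y i))"

lemma tensor_power_exists:
  fixes scaleV :: "complex \<Rightarrow> 'v::ab_group_add \<Rightarrow> 'v"
  assumes "complex_inner_space scaleV ipV" and "orthonormal_basis scaleV ipV k e"
  shows "\<exists>scaleW ipW (tens :: (nat \<Rightarrow> 'v) \<Rightarrow> ((nat \<Rightarrow> nat) \<Rightarrow>\<^sub>0 complex)).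
           tensor_power m scaleV ipV scaleW ipW tens"
proof -
  interpret V: complex_inner_space scaleV ipV by fact
  have on: "ipV (e i) (e j) = (if i = j then 1 else 0)" if "i \<in> {1..k}" "j \<in> {1..k}" for i j
    using assms(2) that by (auto simp: orthonormal_basis_def)
  have ip0: "ipV 0 y = 0" for y using V.ip_add_left[of 0 0 y] by simp
  have ip_sum: "ipV (\<Sum>i\<in>A. f i) y = (\<Sum>i\<in>A. ipV (f i) y)" for f y and A :: "nat set"
    by (induction A rule: infinite_finite_induct) (auto simp: ip0 V.ip_add_left)
  have parseval: "ipV x y = (\<Sum>j\<in>{1..k}. ipV x (e j) * cnj (ipV y (e j)))" for x y
  proof -
    have "x \<in> module.span scaleV (e ` {1..k})" using assms(2) by (simp add: orthonormal_basis_def)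
    then obtain c where "x = (\<Sum>v\<in>e ` {1..k}. scaleV (c v) v)"
      by (subst (asm) V.span_finite) auto
    moreover have "inj_on e {1..k}"
      using on by (intro inj_onI) (metis zero_neq_one)
    ultimately have x: "x = (\<Sum>j\<in>{1..k}. scaleV (c (e j)) (e j))"
      by (simp add: sum.reindex)
    have c: "ipV x (e i) = c (e i)" if "i \<in> {1..k}" for i
    proof -
      have "ipV x (e i) = (\<Sum>j\<in>{1..k}. if j = i then c (e i) else 0)"
        by (subst x, subst ip_sum, intro sum.cong refl) (use that in \<open>auto simp: V.ip_scale_left on\<close>)
      with that show ?thesis by (simp add: sum.delta)
    qed
    have "ipV x y = (\<Sum>j\<in>{1..k}. c (e j) * ipV (e j) y)"
      by (subst x) (simp add: ip_sum V.ip_scale_left)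
    also have "\<dots> = (\<Sum>j\<in>{1..k}. ipV x (e j) * cnj (ipV y (e j)))"
      by (intro sum.cong refl) (metis c V.ip_commute)
    finally show ?thesis .
  qed
  define sc :: "complex \<Rightarrow> ((nat \<Rightarrow> nat) \<Rightarrow>\<^sub>0 complex) \<Rightarrow> _" where
    "sc c f = Poly_Mapping.map ((*) c) f" for c f
  have sc: "Poly_Mapping.lookup (sc c f) a = c * Poly_Mapping.lookup f a" for c f a
    unfolding sc_def by transfer (simp add: when_def)
  define ip where
    "ip f g = (\<Sum>a\<in>Poly_Mapping.keys f. Poly_Mapping.lookup f a * cnj (Poly_Mapping.lookup g a))" for f g :: "(nat \<Rightarrow> nat) \<Rightarrow>\<^sub>0 complex"
  have ip: "ip f g = (\<Sum>a\<in>A. Poly_Mapping.lookup f a * cnj (Poly_Mapping.lookup g a))" if "finite A" "Poly_Mapping.keys f \<subseteq> A" for f g A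
    unfolding ip_def using that by (intro sum.mono_neutral_left) (auto simp: in_keys_iff)
  define co where "co x a = (\<Prod>i\<in>{1..m}. ipV (x i) (e (a i)))" for x :: "nat \<Rightarrow> 'v" and a
  define \<Gamma> where "\<Gamma> = ({1..m} \<rightarrow>\<^sub>E {1..k} :: (nat \<Rightarrow> nat) set)"
  have fin: "finite \<Gamma>" unfolding \<Gamma>_def by (intro finite_PiE) auto
  define tens where "tens x = (\<Sum>a\<in>\<Gamma>. Poly_Mapping.single a (co x a))" for x
  have tens: "Poly_Mapping.lookup (tens x) b = (if b \<in> \<Gamma> then co x b else 0)" for x b
    using fin by (simp add: tens_def lookup_sum lookup_single when_def)
  have co_upd: "co (x(i := u)) b = ipV u (e (b i)) * (\<Prod>j\<in>{1..m} - {i}. ipV (x j) (e (b j)))"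
    if "i \<in> {1..m}" for x i u b
    unfolding co_def using that by (subst prod.remove[of _ i]) (auto intro!: prod.cong)
  have "tensor_power m scaleV ipV sc ip tens"
  proof unfold_locales
    fix c d :: complex and f g z :: "(nat \<Rightarrow> nat) \<Rightarrow>\<^sub>0 complex"
    show "sc c (f + g) = sc c f + sc c g" "sc (c + d) f = sc c f + sc d f"
      "sc c (sc d f) = sc (c * d) f" "sc 1 f = f"
      by (auto intro!: poly_mapping_eqI simp: sc lookup_add algebra_simps)
    let ?A = "Poly_Mapping.keys f \<union> Poly_Mapping.keys g"
    have k: "Poly_Mapping.keys (f + g) \<subseteq> ?A" by (rule keys_add)
    show "ip (f + g) z = ip f z + ip g z"
      using k by (subst (1 2 3) ip[where A = ?A]) (auto simp: lookup_add algebra_simps sum.distrib)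
    have "Poly_Mapping.keys (sc c f) \<subseteq> Poly_Mapping.keys f" by (auto simp: in_keys_iff sc)
    then show "ip (sc c f) g = c * ip f g"
      by (subst (1 2) ip[where A = "Poly_Mapping.keys f"]) (auto simp: sc sum_distrib_left algebra_simps)
    show "ip f g = cnj (ip g f)"
      by (subst (1 2) ip[where A = ?A]) (auto simp: algebra_simps)
    show "Re (ip f f) > 0" if "f \<noteq> 0"
    proof -
      have "ip f f = of_real (\<Sum>a\<in>Poly_Mapping.keys f. (cmod (Poly_Mapping.lookup f a))\<^sup>2)"
        unfolding ip_def by (simp add: complex_norm_square del: of_real_power)
      moreover have "(\<Sum>a\<in>Poly_Mapping.keys f. (cmod (Poly_Mapping.lookup f a))\<^sup>2) > 0"
        using that by (intro sum_pos) (auto simp: in_keys_iff)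
      ultimately show ?thesis by simp
    qed
  next
    fix x y :: "nat \<Rightarrow> 'v" assume "\<And>i. i \<in> {1..m} \<Longrightarrow> x i = y i"
    then have "co x b = co y b" for b by (simp add: co_def)
    then show "tens x = tens y" by (simp add: tens_def)
  next
    fix i :: nat and x u v c assume i: "i \<in> {1..m}"
    show "tens (x(i := u + v)) = tens (x(i := u)) + tens (x(i := v))"
      by (rule poly_mapping_eqI)
         (simp add: tens lookup_add co_upd[OF i] V.ip_add_left algebra_simps)
    show "tens (x(i := scaleV c u)) = sc c (tens (x(i := u)))"
      by (rule poly_mapping_eqI) (simp add: tens sc co_upd[OF i] V.ip_scale_left)
  next
    fix x y :: "nat \<Rightarrow> 'v"
    have "ip (tens x) (tens y) = (\<Sum>a\<in>\<Gamma>. co x a * cnj (co y a))"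
      using fin by (subst ip[where A = \<Gamma>]) (auto simp: tens in_keys_iff split: if_splits)
    also have "\<dots> = (\<Sum>a\<in>\<Gamma>. \<Prod>i\<in>{1..m}. ipV (x i) (e (a i)) * cnj (ipV (y i) (e (a i))))"
      by (simp add: co_def prod.distrib)
    also have "\<dots> = (\<Prod>i\<in>{1..m}. \<Sum>j\<in>{1..k}. ipV (x i) (e j) * cnj (ipV (y i) (e j)))"
      unfolding \<Gamma>_def by (rule prod_sum_PiE[symmetric]) auto
    also have "\<dots> = (\<Prod>i\<in>{1..m}. ipV (x i) (y i))" by (simp only: parseval[symmetric])
    finally show "ip (tens x) (tens y) = (\<Prod>i\<in>{1..m}. ipV (x i) (y i))" .
  qed
  then show ?thesis by blast
qed


section \<open>The semi-dihedral group in \<open>S\<^sub>4\<^sub>n\<close>\<close>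

definition resid :: "nat \<Rightarrow> nat \<Rightarrow> nat" where
  "resid m x = (if x mod m = 0 then m else x mod m)"

definition sd_a :: "nat \<Rightarrow> nat \<Rightarrow> nat" where
  "sd_a n u = (if u \<in> {1..4*n} then resid (4*n) (u + 1) else u)"

definition sd_b :: "nat \<Rightarrow> nat \<Rightarrow> nat" where
  "sd_b n u = (if u \<in> {1..4*n} then resid (4*n) ((2*n - 1) * u) else u)"

definition SD :: "nat \<Rightarrow> (nat \<Rightarrow> nat) set" where
  "SD n = generate (sym_group (4*n)) {sd_a n, sd_b n}"

definition p_regular :: "nat \<Rightarrow> nat \<Rightarrow> (nat \<Rightarrow> nat) set" where
  "p_regular p n = {\<sigma> \<in> SD n. \<not> p dvd group.ord (sym_group (4*n)) \<sigma>}"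

definition cyclicC :: "nat \<Rightarrow> nat \<Rightarrow> nat \<Rightarrow> (nat \<Rightarrow> nat) set" where
  "cyclicC n p t = generate (sym_group (4*n)) {sd_a n ^^ (p ^ t)}"

text \<open>
  For even \<open>h\<close> with \<open>0 < h < 2n\<close> this is the irreducible character \<open>\<psi>\<^sub>h\<close> (\<open>n\<close> even) or
  \<open>\<psi>'\<^sub>h\<close> (\<open>n\<close> odd) on \<open>SD n\<close>; the two are given by the same formula. The value does not depend on
  the chosen exponent (\<open>psi_sd_a\<close>, \<open>psi_sd_b\<close> below).
\<close>

definition psi :: "nat \<Rightarrow> nat \<Rightarrow> (nat \<Rightarrow> nat) \<Rightarrow> complex" where
  "psi n h \<sigma> =
     (if \<exists>r. \<sigma> = sd_a n ^^ r
      then of_real (2 * cos (real h * real (SOME r. \<sigma> = sd_a n ^^ r) * pi / (2 * real n)))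
      else 0)"

definition psi_hat :: "nat \<Rightarrow> nat \<Rightarrow> nat \<Rightarrow> (nat \<Rightarrow> nat) \<Rightarrow> complex" where
  "psi_hat p n h = restrict (psi n h) (p_regular p n)"

lemma resid_in: "m > 0 \<Longrightarrow> resid m x \<in> {1..m}"
  using mod_less_divisor[of m x] by (auto simp: resid_def)

lemma resid_mod: "resid m x mod m = x mod m"
  by (auto simp: resid_def)

lemma resid_eq_iff: "resid m x = resid m y \<longleftrightarrow> x mod m = y mod m"
  by (metis resid_def resid_mod)

lemma resid_id: "u \<in> {1..m} \<Longrightarrow> resid m u = u"
  by (cases "u = m") (auto simp: resid_def)

lemma sd_a_pow: "(sd_a n ^^ r) u = (if u \<in> {1..4*n} then resid (4*n) (u + r) else u)"
proof (induction r)
  case 0 then show ?case by (auto simp: resid_id)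
next
  case (Suc r)
  show ?case
  proof (cases "u \<in> {1..4*n}")
    case True
    then have "resid (4*n) (u + r) \<in> {1..4*n}" by (intro resid_in) auto
    moreover have "resid (4*n) (resid (4*n) (u + r) + 1) = resid (4*n) (u + Suc r)"
      unfolding resid_eq_iff by (metis mod_add_left_eq resid_mod add.assoc Suc_eq_plus1)
    ultimately show ?thesis using Suc True by (simp add: sd_a_def)
  next
    case False then show ?thesis using Suc by (auto simp: sd_a_def)
  qed
qed

lemma sd_a_pow_eq_iff:
  assumes "n > 0"
  shows "sd_a n ^^ r = sd_a n ^^ s \<longleftrightarrow> r mod (4*n) = s mod (4*n)"
proof
  assume "sd_a n ^^ r = sd_a n ^^ s"
  then have "(sd_a n ^^ r) (4*n) = (sd_a n ^^ s) (4*n)" by simp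
  then show "r mod (4*n) = s mod (4*n)"
    using assms by (simp add: sd_a_pow resid_eq_iff)
next
  assume "r mod (4*n) = s mod (4*n)"
  then have "(u + r) mod (4*n) = (u + s) mod (4*n)" for u
    by (metis mod_add_right_eq)
  then show "sd_a n ^^ r = sd_a n ^^ s"
    by (auto simp: sd_a_pow resid_eq_iff)
qed

lemma square_mod: 
  assumes "n > 0" shows "((2*n - 1) * (2*n - 1)) mod (4*n) = (1::nat) mod (4*n)"
proof -
  obtain k where "n = Suc k" using assms by (cases n) auto
  then have "(2*n - 1) * (2*n - 1) = 1 + 4*n*k" by (simp add: algebra_simps)
  then show ?thesis by (metis mod_mult_self2)
qed

lemma sd_b_b: "sd_b n \<circ> sd_b n = id"
proof
  fix u
  show "(sd_b n \<circ> sd_b n) u = id u"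
  proof (cases "u \<in> {1..4*n}")
    case True
    then have n: "n > 0" by auto
    then have r: "resid (4*n) ((2*n - 1) * u) \<in> {1..4*n}" by (intro resid_in) auto
    have "((2*n - 1) * resid (4*n) ((2*n - 1) * u)) mod (4*n) = ((2*n-1) * (2*n-1)) * u mod (4*n)"
      by (metis mod_mult_right_eq resid_mod mult.assoc)
    also have "\<dots> = u mod (4*n)"
      using square_mod[OF n] by (metis mod_mult_left_eq mult_1)
    finally have "resid (4*n) ((2*n - 1) * resid (4*n) ((2*n - 1) * u)) = u"
      using resid_id[OF True] by (metis resid_eq_iff)
    then show ?thesis using True r by (simp add: sd_b_def)
  qed (auto simp: sd_b_def)
qed

lemma sd_b_a_b: "sd_b n \<circ> sd_a n \<circ> sd_b n = sd_a n ^^ (2*n - 1)"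
proof
  fix u
  show "(sd_b n \<circ> sd_a n \<circ> sd_b n) u = (sd_a n ^^ (2*n - 1)) u"
  proof (cases "u \<in> {1..4*n}")
    case True
    then have n: "n > 0" by auto
    let ?m = "4*n" and ?q = "2*n - 1"
    let ?x = "resid ?m (?q * u)" and ?y = "resid ?m (resid ?m (?q * u) + 1)"
    have r: "?x \<in> {1..?m}" "?y \<in> {1..?m}" using n by (intro resid_in; simp)+
    have "(?q * ?y) mod ?m = (?q * (?x + 1)) mod ?m"
      by (metis mod_mult_right_eq resid_mod)
    also have "\<dots> = (?q * (?q * u + 1)) mod ?m"
      by (metis mod_mult_right_eq resid_mod mod_add_left_eq)
    also have "\<dots> = ((?q * ?q) * u + ?q) mod ?m" by (simp only: distrib_left mult.assoc mult_1_right)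
    also have "\<dots> = (u + ?q) mod ?m"
    proof (rule mod_add_cong)
      show "((?q * ?q) * u) mod ?m = u mod ?m"
        using square_mod[OF n] by (metis mod_mult_left_eq mult_1)
    qed simp
    finally have "resid ?m (?q * ?y) = resid ?m (u + ?q)" by (simp add: resid_eq_iff)
    moreover have "(sd_b n \<circ> sd_a n \<circ> sd_b n) u = resid ?m (?q * ?y)"
      using True r by (simp add: sd_b_def sd_a_def del: atLeastAtMost_iff)
    ultimately show ?thesis using True by (simp add: sd_a_pow del: atLeastAtMost_iff)
  next
    case False then show ?thesis by (simp add: sd_b_def sd_a_def sd_a_pow del: atLeastAtMost_iff)
  qed
qed

lemma sd_a_permutes: "sd_a n permutes {1..4*n}"
proof (rule bij_imp_permutes)
  show "bij_betw (sd_a n) {1..4*n} {1..4*n}"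
  proof (rule bij_betw_byWitness[where f' = "sd_a n ^^ (4*n - 1)"])
    have 1: "sd_a n ((sd_a n ^^ (4*n - 1)) u) = u" "(sd_a n ^^ (4*n - 1)) (sd_a n u) = u"
      if "u \<in> {1..4*n}" for u
    proof -
      have n: "n > 0" using that by auto
      have "sd_a n ((sd_a n ^^ (4*n - 1)) u) = (sd_a n ^^ Suc (4*n - 1)) u" by simp
      also have "\<dots> = u" using n that
        by (metis sd_a_pow resid_eq_iff resid_id Suc_diff_1 mod_add_self2 nat_0_less_mult_iff zero_less_numeral)
      finally show "sd_a n ((sd_a n ^^ (4*n - 1)) u) = u" .
      then show "(sd_a n ^^ (4*n - 1)) (sd_a n u) = u" by (metis funpow_swap1)
    qed
    show "\<forall>a\<in>{1..4*n}. (sd_a n ^^ (4*n - 1)) (sd_a n a) = a"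
         "\<forall>a\<in>{1..4*n}. sd_a n ((sd_a n ^^ (4*n - 1)) a) = a" using 1 by blast+
    have 2: "(sd_a n ^^ r) u \<in> {1..4*n}" if "u \<in> {1..4*n}" for r u
    proof -
      have "resid (4*n) (u + r) \<in> {1..4*n}" using that by (intro resid_in) auto
      with that show ?thesis by (simp only: sd_a_pow if_True)
    qed
    show "(sd_a n ^^ (4*n - 1)) ` {1..4*n} \<subseteq> {1..4*n}" using 2 by blast
    show "sd_a n ` {1..4*n} \<subseteq> {1..4*n}" using 2[of _ 1] by auto
  qed
qed (auto simp: sd_a_def)

lemma sd_b_permutes: "sd_b n permutes {1..4*n}"
proof (rule bij_imp_permutes)
  have b: "sd_b n (sd_b n u) = u" for u using sd_b_b[of n] by (metis comp_apply id_apply)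
  have "sd_b n ` {1..4*n} \<subseteq> {1..4*n}"
  proof (clarify, goal_cases)
    case (1 _ u)
    then have "resid (4*n) ((2*n - 1) * u) \<in> {1..4*n}" by (intro resid_in) auto
    with 1 show ?case by (simp only: sd_b_def if_True)
  qed
  then show "bij_betw (sd_b n) {1..4*n} {1..4*n}"
    using b by (intro bij_betw_byWitness[where f' = "sd_b n"]) auto
qed (auto simp: sd_b_def)

lemma sd_b_neq_a_pow:
  assumes "n \<ge> 2" shows "sd_b n \<circ> sd_a n ^^ r \<noteq> sd_a n ^^ s"
proof
  assume *: "sd_b n \<circ> sd_a n ^^ r = sd_a n ^^ s"
  let ?m = "4*n" and ?q = "2*n - 1"
  have A: "(?q * (u + r)) mod ?m = (u + s) mod ?m" if "u \<in> {1..?m}" for u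
  proof -
    have "resid ?m (u + r) \<in> {1..?m}" using assms by (intro resid_in) auto
    then have "resid ?m (?q * resid ?m (u + r)) = resid ?m (u + s)"
      using fun_cong[OF *, of u] that by (simp add: sd_a_pow sd_b_def del: atLeastAtMost_iff)
    then show ?thesis by (metis resid_eq_iff mod_mult_right_eq resid_mod)
  qed
  have "(?q * (1 + r) + ?q) mod ?m = ((1 + s) + 1) mod ?m"
  proof -
    have "?q * (1 + r) + ?q = ?q * (2 + r)" by (simp only: distrib_left mult_1_right mult_2_right add.assoc add.commute)
    then show ?thesis using A[of 2] assms by simp
  qed
  moreover have "(?q * (1 + r) + ?q) mod ?m = ((1 + s) + ?q) mod ?m"
    by (rule mod_add_cong) (use A[of 1] assms in auto)
  ultimately have "((1 + s) + ?q) mod ?m = ((1 + s) + 1) mod ?m" by simp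
  then obtain c d where "(1 + s) + ?q + ?m * c = (1 + s) + 1 + ?m * d"
    unfolding nat_mod_eq_iff by blast
  then have "?q + ?m * c = 1 + ?m * d" by linarith
  then have "?q mod ?m = 1 mod ?m" unfolding nat_mod_eq_iff by blast
  then show False using assms by simp
qed

lemma psi_sd_a:
  assumes "n > 0"
  shows "psi n h (sd_a n ^^ r) = of_real (2 * cos (real h * real r * pi / (2 * real n)))"
proof -
  define s where "s = (SOME s. sd_a n ^^ r = sd_a n ^^ s)"
  have "sd_a n ^^ r = sd_a n ^^ s" unfolding s_def by (rule someI[where x = r]) simp
  then have "int s mod int (4*n) = int r mod int (4*n)"
    using sd_a_pow_eq_iff[OF assms] by (metis of_nat_mod)
  then obtain c where c: "int s = int r + int (4*n) * c"
    by (metis mod_eqE mod_eq_dvd_iff dvdE diff_eq_eq add.commute)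
  have "real s = of_int (int s)" by simp
  also have "\<dots> = real r + 4 * real n * of_int c" unfolding c by simp
  finally have "real h * real s * pi / (2 * real n) =
      real h * real r * pi / (2 * real n) + 2 * pi * of_int (int h * c)"
    using assms by (simp add: field_simps)
  then have "cos (real h * real s * pi / (2 * real n)) = cos (real h * real r * pi / (2 * real n))"
    by (simp add: cos_add cos_int_2pin sin_int_2pin del: of_int_mult)
  then show ?thesis unfolding psi_def s_def by auto
qed

lemma psi_sd_b: "n \<ge> 2 \<Longrightarrow> psi n h (sd_b n \<circ> sd_a n ^^ r) = 0"
  using sd_b_neq_a_pow by (auto simp: psi_def)

lemma SD_eq:
  assumes "n \<ge> 2"
  shows "SD n = {sd_a n ^^ i | i. i < 4*n} \<union> {sd_b n \<circ> sd_a n ^^ i | i. i < 4*n}"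
proof -
  let ?G = "sym_group (4*n)" and ?a = "sd_a n" and ?b = "sd_b n"
  let ?R = "{?a ^^ i | i. True} \<union> {?b \<circ> ?a ^^ i | i. True}"
  have red: "?a ^^ i = ?a ^^ (i mod (4*n))" for i
    using assms by (subst sd_a_pow_eq_iff) auto
  have lt: "i mod (4*n) < 4*n" for i using assms by simp
  have Rlt: "?R = {?a ^^ i | i. i < 4*n} \<union> {?b \<circ> ?a ^^ i | i. i < 4*n}"
  proof (intro equalityI subsetI)
    fix f assume "f \<in> ?R"
    then obtain i where "f = ?a ^^ i \<or> f = ?b \<circ> ?a ^^ i" by blast
    then have "f = ?a ^^ (i mod (4*n)) \<or> f = ?b \<circ> ?a ^^ (i mod (4*n))" using red[of i] by metis
    then show "f \<in> {?a ^^ i | i. i < 4*n} \<union> {?b \<circ> ?a ^^ i | i. i < 4*n}" using lt[of i] by blast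
  qed blast
  have bb: "?b (?b u) = u" for u using sd_b_b[of n] by (metis comp_apply id_apply)
  have ab1: "?a \<circ> ?b = ?b \<circ> ?a ^^ (2*n - 1)"
    unfolding sd_b_a_b[symmetric] by (auto simp: bb)
  have ab: "?a ^^ i \<circ> ?b = ?b \<circ> ?a ^^ ((2*n - 1) * i)" for i
  proof (induction i)
    case (Suc i)
    have "?a ^^ Suc i \<circ> ?b = ?a \<circ> (?a ^^ i \<circ> ?b)" by (simp only: funpow.simps o_assoc)
    also have "\<dots> = (?a \<circ> ?b) \<circ> ?a ^^ ((2*n - 1) * i)" unfolding Suc by (simp add: o_assoc)
    also have "\<dots> = ?b \<circ> ?a ^^ ((2*n - 1) + (2*n - 1) * i)" unfolding ab1 by (simp only: o_assoc funpow_add)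
    finally show ?case by (simp only: mult_Suc_right)
  qed simp
  have mult: "f \<circ> g \<in> ?R" if "f \<in> ?R" "g \<in> ?R" for f g
  proof -
    have 1: "?a ^^ i \<circ> ?a ^^ j \<in> ?R" "(?b \<circ> ?a ^^ i) \<circ> ?a ^^ j \<in> ?R" for i j
      by (auto simp: funpow_add[symmetric] o_assoc[symmetric])
    have 2: "?a ^^ i \<circ> (?b \<circ> ?a ^^ j) = ?b \<circ> ?a ^^ ((2*n - 1) * i + j)" for i j
      by (simp add: o_assoc ab funpow_add)
    have 3: "(?b \<circ> ?a ^^ i) \<circ> (?b \<circ> ?a ^^ j) = ?a ^^ ((2*n - 1) * i + j)" for i j
      by (simp add: o_assoc[symmetric] 2) (auto simp: bb fun_eq_iff)
    have A: "?a ^^ i \<in> ?R" "?b \<circ> ?a ^^ i \<in> ?R" for i by auto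
    from that obtain i j where "f = ?a ^^ i \<or> f = ?b \<circ> ?a ^^ i" "g = ?a ^^ j \<or> g = ?b \<circ> ?a ^^ j"
      by blast
    then show ?thesis using 1[of i j] 2[of i j] 3[of i j] A by (elim disjE) metis+
  qed
  have grp: "group ?G" by (rule sym_group_is_group)
  have inva: "inv\<^bsub>?G\<^esub> ?a = ?a ^^ (4*n - 1)"
  proof (rule group.inv_equality[OF grp])
    have "?a ^^ (4*n - 1) \<circ> ?a = ?a ^^ (4*n)"
      using assms by (metis funpow_Suc_right Suc_diff_1 nat_0_less_mult_iff zero_less_numeral less_le_trans pos2)
    also have "\<dots> = id" using red[of "4*n"] by simp
    finally show "?a ^^ (4*n - 1) \<otimes>\<^bsub>?G\<^esub> ?a = \<one>\<^bsub>?G\<^esub>" by (simp add: sym_group_def)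
    have "(?a ^^ i) permutes {1..4*n}" for i
    proof (induction i)
      case (Suc i)
      then show ?case unfolding funpow.simps using permutes_compose[OF _ sd_a_permutes] by blast
    qed (simp add: permutes_id del: id_apply)
    then show "?a ^^ (4*n - 1) \<in> carrier ?G" by (simp only: sym_group_carrier)
  qed (simp only: sym_group_carrier sd_a_permutes)
  have invb: "inv\<^bsub>?G\<^esub> ?b = ?b"
    by (rule group.inv_equality[OF grp]) (simp_all add: sym_group_def sd_b_b sd_b_permutes del: One_nat_def)
  have gen: "?a \<in> ?R" "?b \<in> ?R"
  proof -
    have "?a ^^ 1 \<in> ?R" "?b \<circ> ?a ^^ 0 \<in> ?R" by blast+
    then show "?a \<in> ?R" "?b \<in> ?R" by simp_all
  qed
  have 1: "f \<in> ?R" if "f \<in> SD n" for f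
    using that unfolding SD_def
  proof (induction rule: generate.induct)
    case one
    have "?a ^^ 0 \<in> ?R" by blast
    then show ?case by (simp only: funpow.simps(1) sym_group_one)
  next
    case (incl h) then show ?case using gen by blast
  next
    case (inv h)
    have "?a ^^ (4*n - 1) \<in> ?R" by blast
    then have "inv\<^bsub>?G\<^esub> ?a \<in> ?R" "inv\<^bsub>?G\<^esub> ?b \<in> ?R" using gen by (simp_all only: inva invb)
    with inv show ?case by blast
  next
    case (eng h1 h2) then show ?case using mult by (simp only: sym_group_mult)
  qed
  have pow: "?a ^^ i \<in> SD n" for i
  proof (induction i)
    case 0 show ?case
      using generate.one[of ?G "{?a, ?b}"] by (simp only: SD_def sym_group_one funpow.simps(1))
  next
    case (Suc i)
    then show ?case
      using generate.eng[OF generate.incl[of ?a "{?a, ?b}" ?G]]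
      by (simp only: SD_def sym_group_mult funpow.simps(2) insertI1 simp_thms)
  qed
  have 2: "?b \<circ> ?a ^^ i \<in> SD n" for i
    using pow[of i] generate.eng[OF generate.incl[of ?b "{?a, ?b}" ?G]]
    by (simp only: SD_def sym_group_mult insertI1 insertI2 simp_thms)
  have "SD n = ?R"
  proof (intro equalityI subsetI)
    fix f assume "f \<in> ?R"
    then obtain i where "f = ?a ^^ i \<or> f = ?b \<circ> ?a ^^ i" by blast
    then show "f \<in> SD n" using pow[of i] 2[of i] by metis
  qed (rule 1)
  from this Rlt show ?thesis by (rule trans)
qed


section \<open>The index set\<close>

definition eps :: "nat \<Rightarrow> nat" where
  "eps n = (if even n then 1 else 2)"

text \<open>
  For odd \<open>p\<close> one has \<open>4 dvd l\<close>, so the divisions below are exact. Upper bounds are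
  written additively to avoid truncated subtraction.
\<close>

definition setE :: "nat \<Rightarrow> nat set" where
  "setE l = {j. even j \<and> 2 \<le> j \<and> j + 2 \<le> l div 2}"

definition setO1 :: "nat \<Rightarrow> nat \<Rightarrow> nat set" where
  "setO1 n l = {j. odd j \<and> j + eps n \<le> l div 4}"

definition setO2 :: "nat \<Rightarrow> nat \<Rightarrow> nat set" where
  "setO2 n l = {l div 2 + i | i. odd i \<and> i + eps n \<le> l div 4}"

definition indexPi :: "nat \<Rightarrow> nat \<Rightarrow> nat \<Rightarrow> nat \<Rightarrow> nat set" where
  "indexPi n p l t =
     (if p \<noteq> 2 then {j * p ^ t | j. j \<in> setE l \<union> setO1 n l \<union> setO2 n l}
      else {j * p ^ t | j. 1 \<le> j \<and> j \<le> (l - 1) div 2})"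


section \<open>Symmetry classes of tensors\<close>

text \<open>With sequences as extensional functions on \<open>{1..m}\<close>, \<open>\<alpha>\<sigma>\<close> is the composition \<open>\<alpha> \<circ> \<sigma>\<close>.\<close>

definition Gamma :: "nat \<Rightarrow> nat \<Rightarrow> (nat \<Rightarrow> nat) set" where
  "Gamma m k = {1..m} \<rightarrow>\<^sub>E {1..k}"

definition stabilizer_seq :: "(nat \<Rightarrow> nat) set \<Rightarrow> (nat \<Rightarrow> nat) \<Rightarrow> (nat \<Rightarrow> nat) set" where
  "stabilizer_seq G \<alpha> = {\<sigma> \<in> G. \<alpha> \<circ> \<sigma> = \<alpha>}"

definition orbit_representatives ::
    "(nat \<Rightarrow> nat) set \<Rightarrow> (nat \<Rightarrow> nat) set \<Rightarrow> (nat \<Rightarrow> nat) set \<Rightarrow> bool" where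
  "orbit_representatives G X \<Delta> \<longleftrightarrow>
     \<Delta> \<subseteq> X \<and> (\<forall>\<alpha>\<in>X. \<exists>!\<gamma>. \<gamma> \<in> \<Delta> \<and> (\<exists>\<sigma>\<in>G. \<alpha> = \<gamma> \<circ> \<sigma>))"

definition t_index :: "nat \<Rightarrow> nat \<Rightarrow> nat \<Rightarrow> nat \<Rightarrow> (nat \<Rightarrow> nat) \<Rightarrow> rat" where
  "t_index n p l t \<gamma> = of_nat l / of_nat (card (cyclicC n p t \<inter> stabilizer_seq (SD n) \<gamma>))"

text \<open>
  \<open>sym_tensor scaleW tens e S \<phi> \<alpha>\<close> is the symmetrized tensor of \<open>\<alpha>\<close> for a function \<open>\<phi>\<close> on the set \<open>S\<close>
  of permutations; \<open>tens (\<lambda>i. e (\<alpha> i))\<close> is the decomposable basis tensor of \<open>\<alpha>\<close>.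
\<close>

definition sym_tensor ::
    "(complex \<Rightarrow> 'w::ab_group_add \<Rightarrow> 'w) \<Rightarrow> ((nat \<Rightarrow> 'v) \<Rightarrow> 'w) \<Rightarrow> (nat \<Rightarrow> 'v) \<Rightarrow>
     (nat \<Rightarrow> nat) set \<Rightarrow> ((nat \<Rightarrow> nat) \<Rightarrow> complex) \<Rightarrow> (nat \<Rightarrow> nat) \<Rightarrow> 'w" where
  "sym_tensor scaleW tens e S \<phi> \<alpha> =
     scaleW (\<phi> id / of_nat (card S))
       (\<Sum>\<sigma>\<in>S. scaleW (\<phi> \<sigma>) (tens (\<lambda>i. e ((\<alpha> \<circ> inv_into UNIV \<sigma>) i))))"

definition symmetry_class ::
    "(complex \<Rightarrow> 'w::ab_group_add \<Rightarrow> 'w) \<Rightarrow> ((nat \<Rightarrow> 'v) \<Rightarrow> 'w) \<Rightarrow> (nat \<Rightarrow> 'v) \<Rightarrow>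
     (nat \<Rightarrow> nat) set \<Rightarrow> ((nat \<Rightarrow> nat) \<Rightarrow> complex) \<Rightarrow> nat \<Rightarrow> nat \<Rightarrow> 'w set" where
  "symmetry_class scaleW tens e S \<phi> m k =
     module.span scaleW (sym_tensor scaleW tens e S \<phi> ` Gamma m k)"

definition has_o_basis ::
    "(complex \<Rightarrow> 'w::ab_group_add \<Rightarrow> 'w) \<Rightarrow> ('w \<Rightarrow> 'w \<Rightarrow> complex) \<Rightarrow> ((nat \<Rightarrow> 'v) \<Rightarrow> 'w) \<Rightarrow>
     (nat \<Rightarrow> 'v) \<Rightarrow> (nat \<Rightarrow> nat) set \<Rightarrow> ((nat \<Rightarrow> nat) \<Rightarrow> complex) \<Rightarrow> nat \<Rightarrow> nat \<Rightarrow> 'w set \<Rightarrow> bool" where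
  "has_o_basis scaleW ipW tens e S \<phi> m k U \<longleftrightarrow>
     (\<exists>B. finite B \<and> B \<subseteq> sym_tensor scaleW tens e S \<phi> ` Gamma m k \<and>
          pairwise (\<lambda>u v. ipW u v = 0) B \<and>
          \<not> module.dependent scaleW B \<and> module.span scaleW B = U)"


section \<open>The 2-adic valuation\<close>

text \<open>
  The value at \<open>0\<close>, which should be infinity, is the junk value \<open>0\<close>; it is only used at
  nonzero arguments.
\<close>

definition nu2 :: "rat \<Rightarrow> int" where
  "nu2 q = int (multiplicity 2 (fst (quotient_of q))) - int (multiplicity 2 (snd (quotient_of q)))"

end

theory Submission
  imports Defs
begin

text \<open>
  The character \<open>\<psi>\<^sub>h\<close> vanishes off the rotations \<open>a\<^sup>r\<close>, and \<open>a\<^sup>r\<close> is \<open>p\<close>-regular exactly when \<open>p\<^sup>t\<close>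
  divides \<open>r\<close>. So only the cyclic group \<open>C\<close> generated by \<open>w = a\<^bsup>p^t\<^esup>\<close>, of order \<open>l\<close>, contributes to a
  symmetrized tensor, and on it the character is \<open>w\<^sup>i \<mapsto> \<omega>\<^sup>i + \<omega>\<^bsup>-i\<^esup>\<close> with \<open>\<omega> = exp (2\<pi>\<i>h/l)\<close>
  (\<open>sym_tensor_eq\<close>). The conditions on \<open>h\<close> give \<open>\<omega>\<^sup>2 \<noteq> 1\<close> (\<open>indexPi_not_dvd\<close>), that is, \<open>\<omega>\<close> and its
  inverse are different characters of \<open>C\<close>.

  Up to a common factor, the symmetrized tensor of \<open>\<alpha>\<close> is therefore \<open>P + Q\<close>, where \<open>P\<close> and \<open>Q\<close> are the
  projections of the basis tensor of \<open>\<alpha>\<close> to the two isotypic parts of \<open>\<omega>\<close> and \<open>\<omega>\<^bsup>-1\<^esup>\<close>. These are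
  orthogonal and of equal length, and they are nonzero exactly when \<open>\<omega>\<close> is trivial on the stabilizer of
  \<open>\<alpha>\<close> in \<open>C\<close>. Since \<open>C\<close> is cyclic, this means that the order \<open>N\<close> of the stabilizer divides \<open>h\<close>
  (\<open>symm_nonzero_iff_card_dvd\<close>), and \<open>h/N\<close> is the number \<open>h t\<^sub>\<gamma>/l\<close> of the second claim.

  Moving \<open>\<alpha>\<close> along its \<open>C\<close>-orbit multiplies \<open>P\<close> and \<open>Q\<close> by mutually inverse powers of \<open>\<omega>\<close>, so two symmetrized
  tensors of one orbit, \<open>c\<close> steps apart, have inner product proportional to \<open>\<omega>\<^sup>c + \<omega>\<^bsup>-c\<^esup>\<close>; different
  orbits are orthogonal. Every orbit that contributes at all spans the plane of \<open>P\<close> and \<open>Q\<close>, hence an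
  o-basis needs two orthogonal symmetrized tensors in that plane, which exist if and only if \<open>\<omega>\<^bsup>2c\<^esup> = -1\<close> for some
  \<open>c\<close>. This criterion does not depend on the orbit (\<open>orthogonal_basis_of_symm\<close>,
  \<open>symm_basis_imp_minus_one_power\<close>), and with two colours there is a sequence with trivial stabilizer, whose
  orbit contributes. Finally \<open>-1\<close> is an even power of \<open>\<omega>\<close> exactly when the reduced denominator of
  \<open>2h/l\<close> is even (\<open>unity_root_even_power_minus_one_iff\<close>).
\<close>

section \<open>Orthogonality in complex inner product spaces\<close>

context complex_inner_space
begin

lemma ip_zero_left [simp]: "ip 0 y = 0"
  using ip_add_left[of 0 0 y] by simp

lemma ip_zero_right [simp]: "ip x 0 = 0"
  using ip_commute[of x 0] by simp

lemma ip_add_right: "ip x (y + z) = ip x y + ip x z"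
  using ip_commute[of x "y + z"] ip_commute[of y x] ip_commute[of z x]
  by (metis ip_add_left ip_commute complex_cnj_add)

lemma ip_scale_right: "ip x (scale c y) = cnj c * ip x y"
  by (metis complex_cnj_mult ip_commute ip_scale_left)

lemma ip_minus_left: "ip (x - y) z = ip x z - ip y z"
  using ip_add_left[of "x - y" y z] by simp

lemma ip_sum_left: "ip (\<Sum>i\<in>A. f i) y = (\<Sum>i\<in>A. ip (f i) y)"
  by (induction A rule: infinite_finite_induct) (auto simp: ip_add_left)

lemma ip_sum_right: "ip x (\<Sum>i\<in>A. f i) = (\<Sum>i\<in>A. ip x (f i))"
  by (induction A rule: infinite_finite_induct) (auto simp: ip_add_right)

lemma ip_self_eq_0_iff: "ip x x = 0 \<longleftrightarrow> x = 0"
  using ip_pos[of x] by fastforce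

lemma span_orthogonal:
  assumes "u \<in> span B" and "\<And>b. b \<in> B \<Longrightarrow> ip b v = 0"
  shows "ip u v = 0"
  using assms(1)
  by (induction rule: span_induct_alt) (auto simp: ip_add_left ip_scale_left assms(2))

lemma orthogonal_independent:
  assumes "pairwise (\<lambda>u v. ip u v = 0) B" and "0 \<notin> B"
  shows "\<not> dependent B"
proof
  assume "dependent B"
  then obtain b where b: "b \<in> B" "b \<in> span (B - {b})"
    by (auto simp: dependent_def)
  have "ip b b = 0"
    using b(2) by (rule span_orthogonal) (use assms(1) b(1) in \<open>auto simp: pairwise_def\<close>)
  with b(1) assms(2) show False by (simp add: ip_self_eq_0_iff)
qed

end


section \<open>Symmetrizing over a cyclic group\<close>

lemma sum_cyclic_shift:
  fixes g :: "nat \<Rightarrow> 'b::ab_group_add"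
  assumes "g l = g 0"
  shows "(\<Sum>i<l. g (Suc i)) = (\<Sum>i<l. g i)"
  using sum.lessThan_Suc[of g l] sum.lessThan_Suc_shift[of g l] assms by simp

lemma sum_cyclic_reverse:
  fixes g :: "nat \<Rightarrow> 'b::ab_group_add"
  assumes "g l = g 0"
  shows "(\<Sum>i<l. g (l - i)) = (\<Sum>i<l. g i)"
proof -
  have "(\<Sum>i<l. g (l - i)) = (\<Sum>i<l. g (Suc (l - Suc i)))"
    by (intro sum.cong refl) (simp add: Suc_diff_Suc)
  also have "\<dots> = (\<Sum>i<l. g (Suc i))"
    by (rule sum.nat_diff_reindex[of "\<lambda>i. g (Suc i)"])
  finally show ?thesis using sum_cyclic_shift[OF assms] by simp
qed

text \<open>
  A generator \<open>T\<close> of a cyclic group of order \<open>l\<close> acts on a finite set \<open>X\<close> that indexes orthogonal vectors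
  \<open>E x\<close> of common squared length \<open>\<kappa>\<close>; \<open>\<omega>\<close> gives a character of this group. The scalar in front of a
  symmetrized tensor will be absorbed into \<open>E\<close>, which is why \<open>\<kappa>\<close> need not be \<open>1\<close>.
\<close>

locale cyclic_symmetrization = complex_inner_space scale ip
  for scale :: "complex \<Rightarrow> 'w::ab_group_add \<Rightarrow> 'w" and ip +
  fixes X :: "'a set" and T :: "'a \<Rightarrow> 'a" and E :: "'a \<Rightarrow> 'w" and \<kappa> :: complex
    and l :: nat and \<omega> :: complex
  assumes finite_X: "finite X"
    and T_in: "x \<in> X \<Longrightarrow> T x \<in> X"
    and T_period: "x \<in> X \<Longrightarrow> (T ^^ l) x = x"
    and l_pos: "l > 0"
    and ip_E: "x \<in> X \<Longrightarrow> y \<in> X \<Longrightarrow> ip (E x) (E y) = (if x = y then \<kappa> else 0)"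
    and \<kappa>_nonzero: "\<kappa> \<noteq> 0"
    and \<omega>_root: "\<omega> ^ l = 1"
    and \<omega>_nonreal: "\<omega>\<^sup>2 \<noteq> 1"
begin

text \<open>
  Up to a factor \<open>l\<close>, the projection of \<open>E x\<close> to the part on which the generator acts by the inverse
  of \<open>z\<close>.
\<close>

definition eig :: "complex \<Rightarrow> 'a \<Rightarrow> 'w" where
  "eig z x = (\<Sum>i<l. scale (z ^ i) (E ((T ^^ i) x)))"

definition symm :: "'a \<Rightarrow> 'w" where
  "symm x = eig \<omega> x + eig (cnj \<omega>) x"

definition sqnorm :: "'a \<Rightarrow> complex" where
  "sqnorm x = ip (eig \<omega> x) (eig \<omega> x)"

lemma T_pow_in: "x \<in> X \<Longrightarrow> (T ^^ i) x \<in> X"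
  by (induction i) (auto simp: T_in)

lemma T_inj: "x \<in> X \<Longrightarrow> y \<in> X \<Longrightarrow> T x = T y \<longleftrightarrow> x = y"
proof -
  assume xy: "x \<in> X" "y \<in> X"
  have "(T ^^ (l - 1)) (T z) = (T ^^ Suc (l - 1)) z" for z
    by (simp only: funpow_Suc_right comp_apply)
  then have "(T ^^ (l - 1)) (T z) = z" if "z \<in> X" for z
    using T_period[OF that] l_pos by simp
  from this[OF xy(1)] this[OF xy(2)] show ?thesis by metis
qed

lemma root_cnj:
  assumes "z ^ l = 1" shows "z * cnj z = 1"
proof -
  have "norm z ^ l = 1" using assms by (metis norm_one norm_power)
  then have "norm z = 1" using l_pos power_eq_imp_eq_base[of "norm z" l 1] by simp
  then show ?thesis by (simp add: complex_norm_square[symmetric])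
qed

lemma \<omega>_cnj: "\<omega> * cnj \<omega> = 1" "\<omega> ^ i * cnj \<omega> ^ i = 1"
  using root_cnj[OF \<omega>_root] by (simp_all flip: power_mult_distrib)

lemma cnj_\<omega>_root: "cnj \<omega> ^ l = 1"
  using \<omega>_root by (metis complex_cnj_one complex_cnj_power)

lemma cnj_\<omega>_neq: "\<omega> \<noteq> cnj \<omega>"
  using \<omega>_cnj \<omega>_nonreal by (metis power2_eq_square)

text \<open>Multiplying the left-hand side by \<open>\<omega>\<^sup>c\<close> turns it into \<open>\<omega>\<^bsup>2c\<^esup> + 1\<close>.\<close>

lemma \<omega>_add_cnj_eq_0_iff: "\<omega> ^ c + cnj \<omega> ^ c = 0 \<longleftrightarrow> \<omega> ^ (2 * c) = -1"
proof -
  have "\<omega> ^ c * (\<omega> ^ c + cnj \<omega> ^ c) = \<omega> ^ (2 * c) + 1"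
    using \<omega>_cnj(2)[of c] by (simp add: distrib_left mult_2 power_add)
  moreover have "\<omega> ^ c \<noteq> 0" using \<omega>_cnj(1) by auto
  ultimately have "\<omega> ^ c + cnj \<omega> ^ c = 0 \<longleftrightarrow> \<omega> ^ (2 * c) + 1 = 0"
    by (metis mult_eq_0_iff)
  then show ?thesis by (simp only: eq_neg_iff_add_eq_0)
qed

lemma eig_T:
  assumes "x \<in> X" "z ^ l = 1"
  shows "scale z (eig z (T x)) = eig z x"
proof -
  let ?g = "\<lambda>i. scale (z ^ i) (E ((T ^^ i) x))"
  have "(\<Sum>i<l. ?g (Suc i)) = (\<Sum>i<l. ?g i)"
    by (rule sum_cyclic_shift) (use assms T_period in simp)
  moreover have "scale z (eig z (T x)) = (\<Sum>i<l. ?g (Suc i))"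
    by (simp add: eig_def scale_sum_right funpow_swap1)
  ultimately show ?thesis by (simp add: eig_def)
qed

lemma eig_T_pow:
  assumes "x \<in> X" "z ^ l = 1"
  shows "eig z ((T ^^ a) x) = scale (cnj z ^ a) (eig z x)"
proof -
  have "scale (z ^ a) (eig z ((T ^^ a) x)) = eig z x"
  proof (induction a)
    case (Suc a)
    have "scale (z ^ Suc a) (eig z ((T ^^ Suc a) x))
      = scale (z ^ a) (scale z (eig z (T ((T ^^ a) x))))" by (simp add: mult.commute)
    then show ?case using eig_T[OF T_pow_in[OF assms(1)] assms(2)] Suc by simp
  qed simp
  then have "scale (cnj z ^ a) (eig z x) = scale (cnj z ^ a * z ^ a) (eig z ((T ^^ a) x))"
    by (simp flip: scale_scale)
  moreover have "cnj z ^ a * z ^ a = 1"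
    using root_cnj[OF assms(2)] by (simp add: mult.commute flip: power_mult_distrib)
  ultimately show ?thesis by simp
qed

lemma symm_T_pow:
  assumes "x \<in> X"
  shows "symm ((T ^^ a) x) = scale (cnj \<omega> ^ a) (eig \<omega> x) + scale (\<omega> ^ a) (eig (cnj \<omega>) x)"
  by (simp only: symm_def eig_T_pow[OF assms \<omega>_root] eig_T_pow[OF assms cnj_\<omega>_root] complex_cnj_cnj)

lemma ip_eig:
  assumes "x \<in> X" "y \<in> X"
  shows "ip (eig z x) (eig z' y) =
    (\<Sum>i<l. \<Sum>j<l. z ^ i * cnj z' ^ j * (if (T ^^ i) x = (T ^^ j) y then \<kappa> else 0))"
proof -
  have "ip (eig z x) (eig z' y) =
    (\<Sum>i<l. \<Sum>j<l. z ^ i * cnj z' ^ j * ip (E ((T ^^ i) x)) (E ((T ^^ j) y)))"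
    unfolding eig_def ip_sum_left
    by (simp only: ip_sum_right ip_scale_left ip_scale_right sum_distrib_left
      mult.assoc mult.left_commute complex_cnj_power)
  then show ?thesis by (simp only: ip_E[OF T_pow_in T_pow_in] assms)
qed

lemma ip_eig_T:
  assumes "x \<in> X" "y \<in> X"
  shows "ip (eig z (T x)) (eig z' (T y)) = ip (eig z x) (eig z' y)"
proof -
  have "(T ^^ i) (T x) = (T ^^ j) (T y) \<longleftrightarrow> (T ^^ i) x = (T ^^ j) y" for i j
    by (simp only: funpow_swap1[symmetric] T_inj[OF T_pow_in[OF assms(1)] T_pow_in[OF assms(2)]])
  then show ?thesis by (simp only: ip_eig[OF assms] ip_eig[OF T_in[OF assms(1)] T_in[OF assms(2)]])
qed

text \<open>
  Isotypic parts of different characters are orthogonal: replacing \<open>x\<close> by \<open>T x\<close> preserves the inner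
  product but multiplies it by a number other than \<open>1\<close>.
\<close>

lemma ip_eig_distinct:
  assumes "x \<in> X" "z ^ l = 1" "z' ^ l = 1" "z \<noteq> z'"
  shows "ip (eig z x) (eig z' x) = 0"
proof -
  let ?A = "ip (eig z x) (eig z' x)"
  have "?A = ip (scale z (eig z (T x))) (scale z' (eig z' (T x)))"
    by (simp only: eig_T[OF assms(1,2)] eig_T[OF assms(1,3)])
  also have "\<dots> = z * cnj z' * ?A"
    by (simp only: ip_scale_left ip_scale_right ip_eig_T[OF assms(1,1)] mult.assoc mult.left_commute)
  finally have "(z * cnj z' - 1) * ?A = 0" by (simp add: left_diff_distrib)
  moreover have "z * cnj z' \<noteq> 1"
  proof
    assume "z * cnj z' = 1"
    then have "z * (z' * cnj z') = z'" by (simp add: mult.left_commute)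
    then show False using root_cnj[OF assms(3)] assms(4) by simp
  qed
  ultimately show ?thesis by simp
qed

text \<open>
  Conjugating \<open>\<omega>\<close> exchanges the roles of the two summation indices, so the components for \<open>\<omega>\<close> and its
  inverse have equal length.
\<close>

lemma ip_eig_cnj:
  assumes "x \<in> X"
  shows "ip (eig (cnj \<omega>) x) (eig (cnj \<omega>) x) = sqnorm x"
proof -
  have "ip (eig (cnj \<omega>) x) (eig (cnj \<omega>) x) =
    (\<Sum>j<l. \<Sum>i<l. cnj \<omega> ^ i * \<omega> ^ j * (if (T ^^ i) x = (T ^^ j) x then \<kappa> else 0))"
    by (subst sum.swap) (simp add: ip_eig assms)
  also have "\<dots> = sqnorm x"
    by (auto simp: sqnorm_def ip_eig assms intro!: sum.cong)
  finally show ?thesis .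
qed

lemma ip_eig_other_orbit:
  assumes "x \<in> X" "y \<in> X" "\<And>c. y \<noteq> (T ^^ c) x"
  shows "ip (eig z x) (eig z' y) = 0"
proof -
  have "(T ^^ i) x \<noteq> (T ^^ j) y" if "j < l" for i j
  proof
    assume "(T ^^ i) x = (T ^^ j) y"
    then have "(T ^^ (l - j + i)) x = (T ^^ (l - j + j)) y" by (simp add: funpow_add)
    also have "\<dots> = y" using that T_period assms(2) by simp
    finally show False using assms(3) by metis
  qed
  then show ?thesis by (simp add: ip_eig assms)
qed

lemma ip_symm_other_orbit:
  assumes "x \<in> X" "y \<in> X" "\<And>c. y \<noteq> (T ^^ c) x"
  shows "ip (eig z x) (symm y) = 0" "ip (symm x) (symm y) = 0"
  using ip_eig_other_orbit[OF assms] by (simp_all add: symm_def ip_add_left ip_add_right)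

lemma ip_eig_symm:
  assumes "x \<in> X"
  shows "ip (eig \<omega> x) (symm x) = sqnorm x" "ip (eig (cnj \<omega>) x) (symm x) = sqnorm x"
  using ip_eig_distinct[OF assms \<omega>_root cnj_\<omega>_root cnj_\<omega>_neq]
    ip_eig_distinct[OF assms cnj_\<omega>_root \<omega>_root cnj_\<omega>_neq[symmetric]] ip_eig_cnj[OF assms]
  by (simp_all add: symm_def ip_add_right sqnorm_def)

text \<open>
  The key formula: inside one orbit, orthogonality only depends on the number \<open>c\<close> of steps between the
  two vectors.
\<close>

lemma ip_symm_same_orbit:
  assumes "x \<in> X"
  shows "ip (symm x) (symm ((T ^^ c) x)) = sqnorm x * (\<omega> ^ c + cnj \<omega> ^ c)"
  using ip_eig_distinct[OF assms \<omega>_root cnj_\<omega>_root cnj_\<omega>_neq]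
    ip_eig_distinct[OF assms cnj_\<omega>_root \<omega>_root cnj_\<omega>_neq[symmetric]] ip_eig_cnj[OF assms]
  unfolding symm_T_pow[OF assms]
  by (simp add: symm_def ip_add_left ip_add_right ip_scale_right sqnorm_def algebra_simps)

lemma symm_eq_0_iff: 
  assumes "x \<in> X" shows "symm x = 0 \<longleftrightarrow> eig \<omega> x = 0"
proof -
  have "ip (symm x) (symm x) = 2 * sqnorm x" using ip_symm_same_orbit[OF assms, of 0] by simp
  then show ?thesis using ip_self_eq_0_iff by (metis mult_eq_0_iff sqnorm_def zero_neq_numeral)
qed

lemma symm_T_pow_eq_0_iff:
  assumes "x \<in> X" shows "symm ((T ^^ i) x) = 0 \<longleftrightarrow> symm x = 0"
proof -
  have "cnj \<omega> \<noteq> 0" using \<omega>_cnj(1) by auto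
  then show ?thesis by (simp add: symm_eq_0_iff assms T_pow_in eig_T_pow[OF _ \<omega>_root])
qed

text \<open>
  An element \<open>T\<^sup>i\<close> of the stabilizer fixes \<open>eig \<omega> x\<close> but also multiplies it by \<open>\<omega>\<^bsup>-i\<^esup>\<close>. Conversely, if all
  these factors are \<open>1\<close>, nothing cancels in the coefficient of \<open>E x\<close>.
\<close>

lemma symm_nonzero_iff_character_trivial:
  assumes "x \<in> X"
  shows "symm x \<noteq> 0 \<longleftrightarrow> (\<forall>i. (T ^^ i) x = x \<longrightarrow> \<omega> ^ i = 1)"
proof
  assume nz: "symm x \<noteq> 0"
  show "\<forall>i. (T ^^ i) x = x \<longrightarrow> \<omega> ^ i = 1"
  proof (intro allI impI)
    fix i assume "(T ^^ i) x = x"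
    then have "scale 1 (eig \<omega> x) = scale (cnj \<omega> ^ i) (eig \<omega> x)"
      using eig_T_pow[OF assms \<omega>_root, of i] by simp
    then have "cnj \<omega> ^ i = 1" using nz symm_eq_0_iff[OF assms] scale_right_imp_eq by metis
    then show "\<omega> ^ i = 1" using \<omega>_cnj(2)[of i] by simp
  qed
next
  assume triv: "\<forall>i. (T ^^ i) x = x \<longrightarrow> \<omega> ^ i = 1"
  have "ip (eig \<omega> x) (E x) = (\<Sum>i<l. \<omega> ^ i * (if (T ^^ i) x = x then \<kappa> else 0))"
    by (simp add: eig_def ip_sum_left ip_scale_left ip_E T_pow_in assms)
  also have "\<dots> = (\<Sum>i<l. if (T ^^ i) x = x then \<kappa> else 0)"
    using triv by (intro sum.cong) auto
  also have "\<dots> = of_nat (card {i. i < l \<and> (T ^^ i) x = x}) * \<kappa>"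
    by (subst sum.inter_filter[symmetric]) auto
  finally have *: "ip (eig \<omega> x) (E x) = \<dots>" .
  have "0 \<in> {i. i < l \<and> (T ^^ i) x = x}" using l_pos by simp
  then have "card {i. i < l \<and> (T ^^ i) x = x} \<noteq> 0" by (metis card_0_eq empty_iff finite_Collect_conjI finite_Collect_less_nat)
  then have "ip (eig \<omega> x) (E x) \<noteq> 0" using * \<kappa>_nonzero by simp
  then show "symm x \<noteq> 0" by (metis ip_zero_left symm_eq_0_iff[OF assms])
qed

text \<open>
  The stabilizer is generated by \<open>T\<^sup>s\<close> for the length \<open>s\<close> of the orbit, so it has order \<open>N = l/s\<close>, and
  \<open>\<omega>\<close> is trivial on it iff \<open>l = s N\<close> divides \<open>h s\<close>.
\<close>

lemma symm_nonzero_iff_card_dvd: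
  assumes "x \<in> X" and order: "\<And>i. \<omega> ^ i = 1 \<longleftrightarrow> l dvd h * i"
  shows "symm x \<noteq> 0 \<longleftrightarrow> card {i. i < l \<and> (T ^^ i) x = x} dvd h"
proof -
  define s where "s = (LEAST s. 0 < s \<and> (T ^^ s) x = x)"
  have "0 < s \<and> (T ^^ s) x = x"
    unfolding s_def by (rule LeastI[of _ l]) (use l_pos T_period assms in auto)
  then have s: "0 < s" "(T ^^ s) x = x" by auto
  have stab: "(T ^^ i) x = x \<longleftrightarrow> s dvd i" for i
  proof
    assume "(T ^^ i) x = x"
    then have "(T ^^ (i mod s)) x = x" using funpow_mod_eq[OF s(2)] by metis
    moreover have "i mod s < s" using s(1) by simp
    ultimately have "\<not> 0 < i mod s"
      using not_less_Least[of "i mod s" "\<lambda>s. 0 < s \<and> (T ^^ s) x = x"] by (auto simp: s_def)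
    then show "s dvd i" by auto
  next
    assume "s dvd i"
    then show "(T ^^ i) x = x" using funpow_mod_eq[OF s(2), of i] by auto
  qed
  obtain N where N: "l = s * N" using stab[of l] T_period[OF assms(1)] unfolding dvd_def by blast
  have "{i. i < l \<and> (T ^^ i) x = x} = (*) s ` {..<N}"
    using s(1) by (auto simp: stab N)
  then have card: "card {i. i < l \<and> (T ^^ i) x = x} = N"
    using s(1) by (simp add: card_image inj_on_def)
  have "symm x \<noteq> 0 \<longleftrightarrow> (\<forall>i. s dvd i \<longrightarrow> \<omega> ^ i = 1)"
    using symm_nonzero_iff_character_trivial assms stab by simp
  also have "\<dots> \<longleftrightarrow> \<omega> ^ s = 1" by (auto simp: power_mult)
  also have "\<dots> \<longleftrightarrow> N dvd h" unfolding order N using s(1) by (simp add: mult.commute)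
  finally show ?thesis unfolding card .
qed

text \<open>
  With \<open>\<zeta> = \<omega>\<^sup>c\<close> a square root of \<open>-1\<close>, the two vectors are \<open>P + Q\<close> and \<open>\<zeta> (Q - P)\<close>. They determine \<open>P\<close>
  and \<open>Q\<close>, and these span everything that comes from the orbit.
\<close>

lemma symm_in_span_orthogonal_pair:
  assumes "x \<in> X" and c: "\<omega> ^ (2 * c) = -1"
  shows "symm ((T ^^ a) x) \<in> span {symm x, symm ((T ^^ c) x)}" (is "_ \<in> span ?S")
proof -
  let ?P = "eig \<omega> x" and ?Q = "eig (cnj \<omega>) x" and ?z = "\<omega> ^ c" and ?v = "symm ((T ^^ c) x)"
  have z: "cnj \<omega> ^ c = - ?z" using c \<omega>_add_cnj_eq_0_iff by (metis add_eq_0_iff)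
  have zz: "?z * ?z = -1" using c by (simp add: mult_2 power_add)
  have "scale ?z ?v = ?P - ?Q"
    using zz by (simp add: symm_T_pow[OF assms(1)] z scale_right_distrib scale_right_diff_distrib)
  then have "symm x + scale ?z ?v = scale 2 ?P" "symm x - scale ?z ?v = scale 2 ?Q"
    using scale_left_distrib[of 1 1 ?P] scale_left_distrib[of 1 1 ?Q] by (simp_all add: symm_def)
  then have "?P = scale (1/2) (symm x + scale ?z ?v)" "?Q = scale (1/2) (symm x - scale ?z ?v)"
    by simp_all
  moreover have "scale (1/2) (symm x + scale ?z ?v) \<in> span ?S" "scale (1/2) (symm x - scale ?z ?v) \<in> span ?S"
    by (intro span_scale span_add span_diff span_base insertI1 insertI2)+
  ultimately have "?P \<in> span ?S" "?Q \<in> span ?S" by simp_all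
  then show ?thesis by (simp add: symm_T_pow[OF assms(1)] span_add span_scale)
qed

text \<open>
  Instead of choosing orbit representatives, take a maximal orthogonal set \<open>B\<close> of nonzero vectors
  \<open>symm x\<close>. By maximality every nonzero \<open>symm x\<close> fails to be orthogonal to a member of \<open>B\<close>, which then
  lies in the same orbit. Applying this to \<open>x\<close> and then to the vector that is \<open>c\<close> steps from the
  member found, and so orthogonal to it, yields two members of \<open>B\<close> in the orbit of \<open>x\<close>.
\<close>

lemma orthogonal_basis_of_symm:
  assumes c: "\<omega> ^ (2 * c) = -1"
  obtains B where "finite B" "B \<subseteq> symm ` X" "pairwise (\<lambda>u v. ip u v = 0) B"
    "\<not> dependent B" "span B = span (symm ` X)"
proof -
  define good where "good B \<longleftrightarrow> B \<subseteq> symm ` X - {0} \<and> pairwise (\<lambda>u v. ip u v = 0) B" for B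
  have fin: "finite {B. good B}"
    using finite_X by (auto simp: good_def intro: finite_subset[of _ "Pow (symm ` X)"])
  moreover have "good {}" by (simp add: good_def)
  ultimately obtain B where B: "good B" and mx: "\<And>B'. good B' \<Longrightarrow> B \<subseteq> B' \<Longrightarrow> B' = B"
    using finite_has_maximal[of "{B. good B}"] by blast
  have Bsub: "B \<subseteq> symm ` X" and B0: "0 \<notin> B" and Bpw: "pairwise (\<lambda>u v. ip u v = 0) B"
    using B by (auto simp: good_def)
  have meets: "\<exists>c. symm ((T ^^ c) x) \<in> B \<and> ip (symm x) (symm ((T ^^ c) x)) \<noteq> 0"
    if x: "x \<in> X" "symm x \<noteq> 0" for x
  proof -
    have "\<exists>u\<in>B. ip (symm x) u \<noteq> 0"
    proof (rule ccontr)
      assume "\<not> ?thesis"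
      then have *: "ip (symm x) u = 0" "ip u (symm x) = 0" if "u \<in> B" for u
        using that ip_commute[of u "symm x"] by auto
      have "good (insert (symm x) B)"
        using B x * by (auto simp: good_def pairwise_insert)
      then have "symm x \<in> B" using mx by blast
      then show False using * x ip_self_eq_0_iff by blast
    qed
    then obtain y where "y \<in> X" "symm y \<in> B" "ip (symm x) (symm y) \<noteq> 0"
      using Bsub by blast
    then show ?thesis using ip_symm_other_orbit(2)[OF x(1), of y] by metis
  qed
  have "symm x \<in> span B" if x: "x \<in> X" for x
  proof (cases "symm x = 0")
    case False
    from meets[OF x False] obtain a where a: "symm ((T ^^ a) x) \<in> B" by blast
    define y where "y = (T ^^ a) x"
    have y: "y \<in> X" "symm y \<noteq> 0" using x B0 a by (auto simp: y_def T_pow_in)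
    have y': "(T ^^ c) y \<in> X" "symm ((T ^^ c) y) \<noteq> 0"
      using y by (simp_all add: T_pow_in symm_T_pow_eq_0_iff)
    from meets[OF y'] obtain b where b: "symm ((T ^^ b) ((T ^^ c) y)) \<in> B"
      "ip (symm ((T ^^ c) y)) (symm ((T ^^ b) ((T ^^ c) y))) \<noteq> 0" by blast
    define d where "d = b + c"
    have d: "(T ^^ b) ((T ^^ c) y) = (T ^^ d) y" by (simp add: d_def funpow_add)
    have "ip (symm y) (symm ((T ^^ c) y)) = 0"
      using c \<omega>_add_cnj_eq_0_iff by (simp add: ip_symm_same_orbit y)
    then have "ip (symm ((T ^^ c) y)) (symm y) = 0" by (metis ip_commute complex_cnj_zero)
    then have "symm y \<noteq> symm ((T ^^ d) y)" using b(2) by (auto simp: d)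
    then have "ip (symm y) (symm ((T ^^ d) y)) = 0"
      using Bpw a b(1) by (auto simp: pairwise_def y_def[symmetric] d)
    moreover have "sqnorm y \<noteq> 0"
      using y symm_eq_0_iff by (simp add: sqnorm_def ip_self_eq_0_iff)
    ultimately have "\<omega> ^ (2 * d) = -1"
      by (simp add: ip_symm_same_orbit y \<omega>_add_cnj_eq_0_iff)
    then have "symm ((T ^^ (a * (l - 1))) y) \<in> span {symm y, symm ((T ^^ d) y)}"
      using symm_in_span_orthogonal_pair y by blast
    \<comment> \<open>\<open>T\<^bsup>a(l-1)\<^esup>\<close> is the inverse of \<open>T\<^sup>a\<close>, so it leads back from \<open>y\<close> to \<open>x\<close>.\<close>
    moreover have "(T ^^ (a * (l - 1))) y = x"
    proof -
      have "(T ^^ (a * (l - 1))) y = (T ^^ (a * (l - 1) + a)) x"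
        by (simp only: y_def funpow_add comp_apply)
      also have "a * (l - 1) + a = l * a" using l_pos by (cases l) (auto simp: algebra_simps)
      also have "(T ^^ (l * a)) x = x" using funpow_mod_eq[OF T_period[OF x], of "l * a"] by simp
      finally show ?thesis .
    qed
    moreover have "span {symm y, symm ((T ^^ d) y)} \<subseteq> span B"
      using a b(1) by (intro span_mono) (auto simp: y_def[symmetric] d)
    ultimately show ?thesis by auto
  qed (simp add: span_zero)
  then have "span B = span (symm ` X)"
    using Bsub by (intro equalityI span_mono span_minimal) auto
  moreover have "finite B" using Bsub finite_X finite_surj by blast
  ultimately show ?thesis
    by (intro that[of B] Bsub Bpw orthogonal_independent[OF Bpw B0])
qed

text \<open>
  Some \<open>symm y = P + Q\<close> in the orbit of \<open>x\<close> belongs to \<open>B\<close>. The vector \<open>P - Q\<close> is orthogonal to it because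
  \<open>P\<close> and \<open>Q\<close> have the same length, and it lies in the span because \<open>symm y\<close> and \<open>symm (T y)\<close> are not
  proportional. Hence \<open>B\<close> has a second member that is not orthogonal to \<open>P - Q\<close>; it comes from the same
  orbit and is orthogonal to \<open>symm y\<close>.
\<close>

lemma symm_basis_imp_minus_one_power:
  assumes x: "x \<in> X" "symm x \<noteq> 0"
    and B: "B \<subseteq> symm ` X" "pairwise (\<lambda>u v. ip u v = 0) B" "span B = span (symm ` X)"
  shows "\<exists>c. \<omega> ^ (2 * c) = -1"
proof -
  have detect: "\<exists>b\<in>B. ip u b \<noteq> 0" if "u \<in> span B" "u \<noteq> 0" for u
    by (metis span_orthogonal[of u B u] that ip_commute complex_cnj_zero ip_self_eq_0_iff)
  have "symm x \<in> span B" using x by (auto simp: B(3) span_base)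
  then obtain y where y: "y \<in> X" "symm y \<in> B" "ip (symm x) (symm y) \<noteq> 0"
    using detect x(2) B(1) by blast
  let ?P = "eig \<omega> y" and ?Q = "eig (cnj \<omega>) y"
  have K: "sqnorm y \<noteq> 0"
    using y symm_eq_0_iff[OF y(1)] by (auto simp: sqnorm_def ip_self_eq_0_iff)
  have PQ: "ip (?P - ?Q) (symm y) = 0" "ip (?P - ?Q) ?P = sqnorm y"
    using ip_eig_symm[OF y(1)] ip_eig_distinct[OF y(1) cnj_\<omega>_root \<omega>_root cnj_\<omega>_neq[symmetric]]
    by (simp_all add: ip_minus_left sqnorm_def)
  have "?P - ?Q \<in> span B"
  proof -
    have S: "symm y \<in> span B" "symm ((T ^^ 1) y) \<in> span B"
      unfolding B(3) using y(1) by (auto intro!: span_base T_in)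
    \<comment> \<open>Subtracting \<open>\<omega>\<^bsup>-1\<^esup> (P + Q)\<close> from \<open>symm (T y) = \<omega>\<^bsup>-1\<^esup> P + \<omega> Q\<close> eliminates \<open>P\<close>.\<close>
    have "symm ((T ^^ 1) y) - scale (cnj \<omega>) (symm y) = scale (\<omega> - cnj \<omega>) ?Q"
      by (simp only: symm_T_pow[OF y(1)]) (simp add: symm_def scale_right_distrib scale_left_diff_distrib)
    then have "scale (1 / (\<omega> - cnj \<omega>)) (symm ((T ^^ 1) y) - scale (cnj \<omega>) (symm y)) = ?Q"
      using cnj_\<omega>_neq by simp
    then have Q: "?Q \<in> span B" using S by (metis span_diff span_scale)
    moreover have "?P - ?Q = symm y - ?Q - ?Q" by (simp add: symm_def)
    ultimately show ?thesis using S(1) by (metis span_diff)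
  qed
  moreover have "?P - ?Q \<noteq> 0" using PQ(2) K by auto
  ultimately obtain y' where y': "y' \<in> X" "symm y' \<in> B" "ip (?P - ?Q) (symm y') \<noteq> 0"
    using detect[of "?P - ?Q"] B(1) by blast
  then obtain c where c: "y' = (T ^^ c) y"
    using ip_symm_other_orbit(1)[OF y(1) y'(1)] by (metis diff_self ip_minus_left)
  have "symm y \<noteq> symm y'" using PQ(1) y'(3) by auto
  then have "ip (symm y) (symm y') = 0" using B(2) y(2) y'(2) by (auto simp: pairwise_def)
  then show ?thesis
    using K by (auto simp: c ip_symm_same_orbit[OF y(1)] \<omega>_add_cnj_eq_0_iff)
qed

end


section \<open>The root of unity\<close>

definition unity_root :: "nat \<Rightarrow> nat \<Rightarrow> complex" where
  "unity_root l h = cis (2 * pi * real h / real l)"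

lemma unity_root_power_eq_1_iff:
  assumes "l > 0"
  shows "unity_root l h ^ i = 1 \<longleftrightarrow> l dvd h * i"
proof -
  let ?x = "real i * (2 * pi * real h / real l)"
  have "unity_root l h ^ i = 1 \<longleftrightarrow> cos ?x = 1"
  proof
    assume "cos ?x = 1"
    moreover from this have "sin ?x = 0" using sin_cos_squared_add[of ?x] by simp
    ultimately show "unity_root l h ^ i = 1"
      by (simp add: unity_root_def DeMoivre complex_eq_iff)
  qed (simp add: unity_root_def DeMoivre complex_eq_iff)
  also have "\<dots> \<longleftrightarrow> (\<exists>m::int. ?x = of_int m * 2 * pi)" by (rule cos_one_2pi_int)
  also have "\<dots> \<longleftrightarrow> (\<exists>m::int. int (h * i) = int l * m)"
  proof (rule arg_cong[where f = Ex], rule ext)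
    fix m :: int
    have "?x = of_int m * 2 * pi \<longleftrightarrow> real h * real i = real l * of_int m"
      using assms by (simp add: field_simps)
    also have "\<dots> \<longleftrightarrow> real_of_int (int (h * i)) = real_of_int (int l * m)" by simp
    also have "\<dots> \<longleftrightarrow> int (h * i) = int l * m" by (rule of_int_eq_iff)
    finally show "?x = of_int m * 2 * pi \<longleftrightarrow> int (h * i) = int l * m" .
  qed
  also have "\<dots> \<longleftrightarrow> l dvd h * i"
    by (simp only: dvd_def[symmetric] int_dvd_int_iff)
  finally show ?thesis .
qed

text \<open>In lowest terms at most one of numerator and denominator is even.\<close>

lemma nu2_neg_iff:
  assumes "quotient_of q = (a, b)"
  shows "nu2 q < 0 \<longleftrightarrow> even b"
proof -
  have b: "b > 0" and ab: "coprime a b"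
    using assms by (auto dest: quotient_of_denom_pos quotient_of_coprime)
  show ?thesis
  proof (cases "even b")
    case True
    then have "odd a" using ab by (auto dest: coprime_common_divisor)
    moreover have "multiplicity 2 b > 0" using True b by (simp add: multiplicity_gt_zero_iff)
    ultimately show ?thesis using True assms by (simp add: nu2_def not_dvd_imp_multiplicity_0)
  next
    case False
    then show ?thesis using assms by (simp add: nu2_def not_dvd_imp_multiplicity_0)
  qed
qed

text \<open>
  A number is \<open>-1\<close> iff its square is \<open>1\<close> and it is not \<open>1\<close> itself. If \<open>2h/l = a/b\<close> in lowest terms, then
  \<open>\<omega>\<^bsup>2c\<^esup> = 1\<close> iff \<open>b\<close> divides \<open>c\<close>; so some \<open>c\<close> with \<open>b\<close> dividing \<open>2c\<close> but not \<open>c\<close> is wanted: an odd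
  multiple of \<open>b/2\<close>.
\<close>

lemma unity_root_even_power_minus_one_iff:
  assumes "l > 0"
  shows "(\<exists>c. unity_root l h ^ (2 * c) = -1) \<longleftrightarrow> nu2 (2 * of_nat h / of_nat l) < 0"
proof -
  let ?\<omega> = "unity_root l h"
  obtain a b where ab: "quotient_of (2 * of_nat h / of_nat l) = (a, b)" by fastforce
  have b: "b > 0" and cop: "coprime a b"
    using ab by (auto dest: quotient_of_denom_pos quotient_of_coprime)
  have "(2 * of_nat h / of_nat l :: rat) = of_int a / of_int b" using ab by (rule quotient_of_div)
  then have "of_int (2 * int h * b) = (of_int (a * int l) :: rat)"
    using assms b by (simp add: field_simps)
  then have eq: "2 * int h * b = a * int l" by (simp only: of_int_eq_iff)
  have dvd: "l dvd 2 * h * c \<longleftrightarrow> b dvd int c" for c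
  proof -
    have "l dvd 2 * h * c \<longleftrightarrow> int l * b dvd (2 * int h * int c) * b"
      using b by (subst dvd_mult_cancel_right) (simp flip: int_dvd_int_iff)
    also have "(2 * int h * int c) * b = int l * (a * int c)" using eq by (simp add: algebra_simps)
    also have "int l * b dvd int l * (a * int c) \<longleftrightarrow> b dvd a * int c" using assms by simp
    also have "\<dots> \<longleftrightarrow> b dvd int c"
      using cop by (simp add: coprime_dvd_mult_right_iff coprime_commute)
    finally show ?thesis .
  qed
  have "?\<omega> ^ (2 * c) = -1 \<longleftrightarrow> b dvd 2 * int c \<and> \<not> b dvd int c" for c
  proof -
    have "?\<omega> ^ (2 * c) = -1 \<longleftrightarrow> (?\<omega> ^ (2 * c))\<^sup>2 = 1 \<and> ?\<omega> ^ (2 * c) \<noteq> 1"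
      by (auto simp: power2_eq_1_iff)
    also have "(?\<omega> ^ (2 * c))\<^sup>2 = ?\<omega> ^ (4 * c)" by (simp flip: power_mult)
    also have "?\<omega> ^ (4 * c) = 1 \<longleftrightarrow> b dvd 2 * int c"
      using dvd[of "2 * c"] by (simp add: unity_root_power_eq_1_iff[OF assms] mult_ac)
    also have "?\<omega> ^ (2 * c) = 1 \<longleftrightarrow> b dvd int c"
      using dvd[of c] by (simp add: unity_root_power_eq_1_iff[OF assms] mult_ac)
    finally show ?thesis .
  qed
  then have "(\<exists>c. ?\<omega> ^ (2 * c) = -1) \<longleftrightarrow> (\<exists>c. b dvd 2 * int c \<and> \<not> b dvd int c)" by simp
  also have "\<dots> \<longleftrightarrow> even b"
  proof
    assume "\<exists>c. b dvd 2 * int c \<and> \<not> b dvd int c"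
    then show "even b"
      by (metis coprime_dvd_mult_right_iff coprime_right_2_iff_odd)
  next
    assume "even b"
    then obtain d where d: "b = 2 * d" by blast
    then have "b dvd 2 * int (nat d)" "\<not> b dvd int (nat d)" using b by (auto dest: zdvd_imp_le)
    then show "\<exists>c. b dvd 2 * int c \<and> \<not> b dvd int c" by blast
  qed
  finally show ?thesis using nu2_neg_iff[OF ab] by simp
qed


section \<open>The p-regular rotations\<close>

lemma funpow_precompose:
  fixes f :: "'a \<Rightarrow> 'a" and \<alpha> :: "'a \<Rightarrow> 'b"
  shows "((\<lambda>\<alpha>. \<alpha> \<circ> f) ^^ i) \<alpha> = \<alpha> \<circ> f ^^ i"
proof (induction i)
  case (Suc i)
  have "((\<lambda>\<alpha>. \<alpha> \<circ> f) ^^ Suc i) \<alpha> = (((\<lambda>\<alpha>. \<alpha> \<circ> f) ^^ i) \<alpha>) \<circ> f" by simp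
  also have "\<dots> = \<alpha> \<circ> f ^^ Suc i" by (simp only: Suc funpow_Suc_right o_assoc)
  finally show ?case .
qed simp

lemma sym_group_pow:
  "f [^]\<^bsub>sym_group m\<^esub> i = f ^^ (i::nat)"
proof -
  interpret group "sym_group m" by (rule sym_group_is_group)
  show ?thesis
    by (induction i)
       (simp_all only: nat_pow_0 nat_pow_Suc sym_group_one sym_group_mult funpow.simps(1) funpow_Suc_right)
qed

lemma sd_a_pow_permutes: "sd_a n ^^ r permutes {1..4*n}"
  by (rule permutes_funpow) (rule sd_a_permutes)

lemma sd_a_pow_eq_id_iff: "n > 0 \<Longrightarrow> sd_a n ^^ r = id \<longleftrightarrow> 4*n dvd r"
  using sd_a_pow_eq_iff[of n r 0] by (simp add: dvd_eq_mod_eq_0)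

locale regular_rotations =
  fixes n p l t :: nat
  assumes n_ge_2: "n \<ge> 2" and prime_p: "prime p" and factored: "4*n = l * p ^ t"
    and not_dvd_l: "\<not> p dvd l"
begin

abbreviation w :: "nat \<Rightarrow> nat" where
  "w \<equiv> sd_a n ^^ (p ^ t)"

lemma l_pos: "l > 0"
  using factored n_ge_2 by (cases l) auto

lemma p_pos: "p > 0"
  using prime_p by (simp add: prime_gt_0_nat)

lemma w_pow: "w ^^ i = sd_a n ^^ (p ^ t * i)"
  by (rule funpow_mult)

lemma w_pow_eq_iff: "w ^^ i = w ^^ j \<longleftrightarrow> i mod l = j mod l"
  using n_ge_2 p_pos
  by (simp add: w_pow sd_a_pow_eq_iff factored mult.commute[of l] flip: mult_mod_right)

lemma w_pow_l: "w ^^ l = id"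
  using w_pow_eq_iff[of l 0] by simp

text \<open>
  The order \<open>d\<close> of \<open>a\<^sup>r\<close> is the least positive solution of \<open>l p\<^sup>t dvd r d\<close>. If it is prime to \<open>p\<close>, then \<open>p\<^sup>t\<close> must divide
  \<open>r\<close>; if \<open>p\<^sup>t\<close> divides \<open>r\<close>, then \<open>d\<close> divides \<open>l\<close>.
\<close>

lemma sd_a_pow_p_regular_iff: "sd_a n ^^ r \<in> p_regular p n \<longleftrightarrow> p ^ t dvd r"
proof -
  interpret group "sym_group (4*n)" by (rule sym_group_is_group)
  define d where "d = ord (sd_a n ^^ r)"
  have d: "d dvd i \<longleftrightarrow> l * p ^ t dvd r * i" for i
    using pow_eq_id[of "sd_a n ^^ r" i] sd_a_pow_permutes n_ge_2
    by (simp add: d_def sym_group_pow sym_group_carrier sym_group_one funpow_mult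
      sd_a_pow_eq_id_iff flip: factored)
  have "r mod (4*n) < 4*n" using n_ge_2 by simp
  moreover have "sd_a n ^^ r = sd_a n ^^ (r mod (4*n))"
    using n_ge_2 by (simp add: sd_a_pow_eq_iff)
  ultimately have "sd_a n ^^ r \<in> SD n" unfolding SD_eq[OF n_ge_2] by blast
  then have "sd_a n ^^ r \<in> p_regular p n \<longleftrightarrow> \<not> p dvd d" by (simp add: p_regular_def d_def)
  also have "\<dots> \<longleftrightarrow> p ^ t dvd r"
  proof
    assume "\<not> p dvd d"
    then have "coprime (p ^ t) d" using prime_p by (simp add: prime_imp_coprime)
    moreover have "l * p ^ t dvd r * d" using d[of d] by (simp only: dvd_refl)
    then have "p ^ t dvd r * d" by (rule dvd_mult_right)
    ultimately show "p ^ t dvd r" by (simp add: coprime_dvd_mult_left_iff)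
  next
    assume "p ^ t dvd r"
    then have "l * p ^ t dvd r * l" by (simp add: mult.commute)
    then have "d dvd l" using d by blast
    then show "\<not> p dvd d" using not_dvd_l dvd_trans by blast
  qed
  finally show ?thesis .
qed

lemma w_pow_p_regular: "w ^^ i \<in> p_regular p n"
  by (simp add: w_pow sd_a_pow_p_regular_iff)

lemma finite_p_regular: "finite (p_regular p n)"
proof -
  have "finite (SD n)" by (simp add: SD_eq[OF n_ge_2])
  then show ?thesis by (simp add: p_regular_def)
qed

lemma psi_hat_w_pow:
  "psi_hat p n h (w ^^ i) = unity_root l h ^ i + cnj (unity_root l h) ^ i"
proof -
  have "4 * real n = real l * real p ^ t"
    using arg_cong[OF factored, of real] by simp
  then have "real h * real (p ^ t * i) * pi / (2 * real n) = real i * (2 * pi * real h / real l)"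
    using l_pos n_ge_2 by (simp add: field_simps)
  then show ?thesis
    using n_ge_2 w_pow_p_regular[of i]
    by (simp add: psi_hat_def w_pow psi_sd_a unity_root_def DeMoivre cis_cnj complex_eq_iff
      del: of_nat_mult of_nat_power)
qed

lemma psi_hat_eq_0:
  assumes "\<sigma> \<in> p_regular p n" "\<And>i. i < l \<Longrightarrow> \<sigma> \<noteq> w ^^ i"
  shows "psi_hat p n h \<sigma> = 0"
proof -
  have "\<sigma> \<noteq> sd_a n ^^ r" for r
  proof
    assume r: "\<sigma> = sd_a n ^^ r"
    then obtain i where "r = p ^ t * i" using assms(1) sd_a_pow_p_regular_iff by blast
    then have "\<sigma> = w ^^ (i mod l)" using r w_pow w_pow_eq_iff[of i "i mod l"] by simp
    then show False using assms(2) l_pos by simp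
  qed
  then show ?thesis by (simp add: psi_hat_def psi_def assms(1))
qed

lemma inv_w_pow:
  assumes "i \<le> l"
  shows "inv_into UNIV (w ^^ i) = w ^^ (l - i)"
  by (rule inv_unique_comp) (use assms w_pow_l in \<open>simp_all flip: funpow_add\<close>)

lemma inj_on_w_pow: "inj_on (\<lambda>i. w ^^ i) {..<l}"
  by (auto simp: inj_on_def w_pow_eq_iff)

lemma cyclicC_eq: "cyclicC n p t = (\<lambda>i. w ^^ i) ` {..<l}"
proof -
  interpret group "sym_group (4*n)" by (rule sym_group_is_group)
  have "finite (carrier (sym_group (4*n)))"
    by (simp add: sym_group_def finite_permutations)
  then have "cyclicC n p t = {w ^^ k | k. True}"
    unfolding cyclicC_def
    by (subst generate_pow_on_finite_carrier)
       (simp_all add: sym_group_carrier sym_group_pow sd_a_pow_permutes del: One_nat_def)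
  also have "\<dots> = (\<lambda>i. w ^^ i) ` {..<l}"
  proof (intro equalityI subsetI)
    fix \<sigma> assume "\<sigma> \<in> {w ^^ k | k. True}"
    then obtain k where "\<sigma> = w ^^ k" by blast
    then have "\<sigma> = w ^^ (k mod l)" by (simp add: w_pow_eq_iff)
    then show "\<sigma> \<in> (\<lambda>i. w ^^ i) ` {..<l}" using l_pos by auto
  qed blast
  finally show ?thesis .
qed

lemma card_cyclicC_stabilizer:
  "card (cyclicC n p t \<inter> stabilizer_seq (SD n) \<gamma>) = card {i. i < l \<and> \<gamma> \<circ> w ^^ i = \<gamma>}"
proof -
  have "w ^^ i \<in> SD n" for i
    using w_pow_p_regular by (simp add: p_regular_def)
  then have "cyclicC n p t \<inter> stabilizer_seq (SD n) \<gamma> = (\<lambda>i. w ^^ i) ` {i. i < l \<and> \<gamma> \<circ> w ^^ i = \<gamma>}"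
    by (auto simp: cyclicC_eq stabilizer_seq_def)
  moreover have "inj_on (\<lambda>i. w ^^ i) {i. i < l \<and> \<gamma> \<circ> w ^^ i = \<gamma>}"
    by (rule inj_on_subset[OF inj_on_w_pow]) auto
  ultimately show ?thesis by (simp only: card_image)
qed

lemma Gamma_w:
  assumes "\<alpha> \<in> Gamma (4*n) k" shows "\<alpha> \<circ> w \<in> Gamma (4*n) k"
proof -
  have w: "w u \<in> {1..4*n} \<longleftrightarrow> u \<in> {1..4*n}" for u
    by (rule permutes_in_image[OF sd_a_pow_permutes])
  have w': "w u = u" if "u \<notin> {1..4*n}" for u
    using sd_a_pow_permutes that by (rule permutes_not_in)
  have "\<alpha> u \<in> {1..k}" if "u \<in> {1..4*n}" for u
    using assms that unfolding Gamma_def by blast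
  moreover have "\<alpha> u = undefined" if "u \<notin> {1..4*n}" for u
    using assms that unfolding Gamma_def by (rule PiE_arb)
  ultimately show ?thesis
    unfolding Gamma_def by (intro PiE_I) (simp_all only: comp_apply w w' not_False_eq_True)
qed

text \<open>
  Give the point \<open>4n\<close> a colour of its own: a power of \<open>w\<close> that preserves the colouring fixes \<open>4n\<close>, and
  then it is the identity.
\<close>

lemma exists_free_sequence:
  assumes "k \<ge> 2"
  obtains \<delta> where "\<delta> \<in> Gamma (4*n) k" "\<And>i. \<delta> \<circ> w ^^ i = \<delta> \<Longrightarrow> l dvd i"
proof
  define \<delta> :: "nat \<Rightarrow> nat" where "\<delta> = restrict (\<lambda>u. if u = 4*n then 1 else 2) {1..4*n}"
  show "\<delta> \<in> Gamma (4*n) k" using assms by (auto simp: \<delta>_def Gamma_def)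
  fix i assume fix_i: "\<delta> \<circ> w ^^ i = \<delta>"
  let ?u = "resid (4*n) (4*n + p ^ t * i)"
  have u: "?u \<in> {1..4*n}" using n_ge_2 by (intro resid_in) simp
  have \<delta>: "\<delta> u = 1 \<longleftrightarrow> u = 4*n" if "u \<in> {1..4*n}" for u
    using that by (simp add: \<delta>_def del: atLeastAtMost_iff)
  have top: "4*n \<in> {1..4*n}" using n_ge_2 by simp
  then have "(w ^^ i) (4*n) = ?u" by (simp only: w_pow sd_a_pow if_True)
  then have "\<delta> ?u = \<delta> (4*n)" using fun_cong[OF fix_i, of "4*n"] by simp
  then have "?u = 4*n" using \<delta>[OF u] \<delta>[OF top] by simp
  then have "(4*n + p ^ t * i) mod (4*n) = 0" by (metis resid_mod mod_self)
  then have "4*n dvd p ^ t * i" by (simp add: dvd_eq_mod_eq_0)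
  then have "p ^ t * l dvd p ^ t * i" by (simp only: factored mult.commute[of l])
  then show "l dvd i" using p_pos by simp
qed

text \<open>
  This is the statement \<open>\<omega>\<^sup>2 \<noteq> 1\<close>. Write \<open>h = j p\<^sup>t\<close>; then \<open>l dvd 2 h\<close> iff \<open>l dvd 2 j\<close>. For odd \<open>p\<close> also \<open>j\<close> is
  even, and as \<open>4 dvd l\<close> all members of the two sets \<open>O\<^sub>1\<close> and \<open>O\<^sub>2\<close> are odd, so \<open>j\<close> lies in \<open>E\<close>. In every
  case \<open>0 < 2 j < l\<close>.
\<close>

lemma indexPi_not_dvd:
  assumes "h \<in> indexPi n p l t" "even h"
  shows "\<not> l dvd 2 * h"
proof -
  obtain j where j: "h = j * p ^ t" "0 < j" "2 * j < l"
  proof (cases "p = 2")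
    case True
    then show ?thesis using assms(1) that by (auto simp: indexPi_def)
  next
    case False
    then have odd_p: "odd p" using prime_p prime_odd_nat[of p] prime_ge_2_nat[of p] by simp
    then have odd: "odd (p ^ t)" by simp
    obtain j where j: "h = j * p ^ t" "j \<in> setE l \<union> setO1 n l \<union> setO2 n l"
      using assms(1) False by (auto simp: indexPi_def)
    have "even j" using j(1) assms(2) odd_p by simp
    have "coprime (2\<^sup>2) (p ^ t)"
      unfolding coprime_power_left_iff coprime_left_2_iff_odd using odd by blast
    then have "coprime 4 (p ^ t)" by simp
    moreover have "4 dvd l * p ^ t" by (metis dvd_triv_left factored)
    ultimately have "4 dvd l" by (simp add: coprime_dvd_mult_left_iff)
    then have "even (l div 2)" by (auto elim!: dvdE)
    then have "j \<in> setE l" using j(2) \<open>even j\<close> by (auto simp: setO1_def setO2_def)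
    then have "0 < j" "2 * j < l" by (auto simp: setE_def)
    with j(1) show ?thesis by (rule that)
  qed
  have "coprime l (p ^ t)"
    using prime_imp_coprime[OF prime_p not_dvd_l] by (simp add: coprime_commute)
  then have "l dvd 2 * h \<longleftrightarrow> l dvd 2 * j"
    unfolding j(1) mult.assoc[symmetric] by (rule coprime_dvd_mult_left_iff)
  moreover have "\<not> l dvd 2 * j" using j(2,3) by (auto dest: dvd_imp_le)
  ultimately show ?thesis by simp
qed

end

section \<open>Symmetrized tensors\<close>

context regular_rotations
begin

text \<open>
  The definition applies \<open>\<sigma>\<^bsup>-1\<^esup>\<close> to \<open>\<alpha>\<close>. Since the character takes equal values at \<open>w\<^sup>i\<close> and \<open>w\<^bsup>-i\<^esup>\<close>, the sum over
  \<open>C\<close> can be reversed and no inverses remain.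
\<close>

lemma sym_tensor_eq:
  fixes scaleW :: "complex \<Rightarrow> 'w::ab_group_add \<Rightarrow> 'w"
  assumes "vector_space scaleW"
  shows "sym_tensor scaleW tens e (p_regular p n) (psi_hat p n h) \<alpha> =
    (\<Sum>i<l. scaleW (unity_root l h ^ i + cnj (unity_root l h) ^ i)
      (scaleW (psi_hat p n h id / of_nat (card (p_regular p n))) (tens (\<lambda>u. e ((\<alpha> \<circ> w ^^ i) u)))))"
    (is "_ = (\<Sum>i<l. scaleW (?\<chi> i) (scaleW ?c (?v (w ^^ i))))")
proof -
  interpret vector_space scaleW by fact
  let ?\<phi> = "psi_hat p n h"
  let ?f = "\<lambda>\<sigma>. scaleW (?\<phi> \<sigma>) (?v (inv_into UNIV \<sigma>))"
  have root: "unity_root l h ^ l = 1" using l_pos by (simp add: unity_root_power_eq_1_iff)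
  then have "cnj (unity_root l h) ^ l = 1" by (metis complex_cnj_one complex_cnj_power)
  with root have \<chi>_l: "?\<chi> l = ?\<chi> 0" by simp
  have "(\<Sum>\<sigma>\<in>p_regular p n. ?f \<sigma>) = (\<Sum>\<sigma>\<in>(\<lambda>i. w ^^ i) ` {..<l}. ?f \<sigma>)"
  proof (rule sum.mono_neutral_right[OF finite_p_regular])
    show "(\<lambda>i. w ^^ i) ` {..<l} \<subseteq> p_regular p n" using w_pow_p_regular by blast
    show "\<forall>\<sigma>\<in>p_regular p n - (\<lambda>i. w ^^ i) ` {..<l}. ?f \<sigma> = 0"
    proof
      fix \<sigma> assume "\<sigma> \<in> p_regular p n - (\<lambda>i. w ^^ i) ` {..<l}"
      then have "?\<phi> \<sigma> = 0" by (intro psi_hat_eq_0) auto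
      then show "?f \<sigma> = 0" by (simp only: scale_zero_left)
    qed
  qed
  also have "\<dots> = (\<Sum>i<l. ?f (w ^^ i))"
    by (subst sum.reindex[OF inj_on_w_pow]) (simp only: comp_def)
  \<comment> \<open>\<open>i = l - (l - i)\<close> exhibits the summand as a function of \<open>l - i\<close>, ready for the reversal.\<close>
  also have "\<dots> = (\<Sum>i<l. scaleW (?\<chi> (l - (l - i))) (?v (w ^^ (l - i))))"
    by (intro sum.cong refl) (simp only: psi_hat_w_pow inv_w_pow less_imp_le lessThan_iff diff_diff_cancel)
  also have "\<dots> = (\<Sum>i<l. scaleW (?\<chi> (l - i)) (?v (w ^^ i)))"
    by (rule sum_cyclic_reverse[of "\<lambda>i. scaleW (?\<chi> (l - i)) (?v (w ^^ i))"])
       (simp only: w_pow_l diff_zero diff_self_eq_0 \<chi>_l funpow.simps(1))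
  also have "\<dots> = (\<Sum>i<l. scaleW (?\<chi> i) (?v (w ^^ i)))"
  proof (intro sum.cong refl, goal_cases)
    case (1 i)
    have inv: "z ^ (l - i) = cnj z ^ i" if "z ^ l = 1" "z * cnj z = 1" for z :: complex
    proof -
      have "z ^ (l - i) = (z * cnj z) ^ i * z ^ (l - i)" using that(2) by simp
      also have "\<dots> = cnj z ^ i * (z ^ i * z ^ (l - i))" by (simp only: power_mult_distrib mult_ac)
      also have "z ^ i * z ^ (l - i) = 1" using 1 that(1) by (simp flip: power_add)
      finally show ?thesis by simp
    qed
    have "unity_root l h * cnj (unity_root l h) = 1"
      by (simp add: unity_root_def cis_cnj cis_mult)
    then have "?\<chi> (l - i) = ?\<chi> i"
      using inv[of "unity_root l h"] inv[of "cnj (unity_root l h)"] root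
      by (simp add: mult.commute flip: complex_cnj_power)
    then show ?case by (simp only:)
  qed
  finally have "sym_tensor scaleW tens e (p_regular p n) ?\<phi> \<alpha> =
      scaleW ?c (\<Sum>i<l. scaleW (?\<chi> i) (?v (w ^^ i)))"
    by (simp only: sym_tensor_def)
  then show ?thesis by (simp only: scale_sum_right scale_scale mult.commute)
qed

lemma psi_hat_id: "psi_hat p n h id = 2"
  using psi_hat_w_pow[of h 0] by simp

lemma card_p_regular_pos: "card (p_regular p n) > 0"
  using finite_p_regular w_pow_p_regular by (auto simp: card_gt_0_iff)

lemma cyclic_symmetrization_tensors:
  fixes scaleV :: "complex \<Rightarrow> 'v::ab_group_add \<Rightarrow> 'v"
    and scaleW :: "complex \<Rightarrow> 'w::ab_group_add \<Rightarrow> 'w"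
  assumes "tensor_power (4*n) scaleV ipV scaleW ipW tens"
    and on: "orthonormal_basis scaleV ipV k e"
    and "\<not> l dvd 2 * h" and "c \<noteq> 0"
  shows "cyclic_symmetrization scaleW ipW (Gamma (4*n) k) (\<lambda>\<alpha>. \<alpha> \<circ> w)
    (\<lambda>\<alpha>. scaleW c (tens (\<lambda>u. e (\<alpha> u)))) (c * cnj c) l (unity_root l h)"
proof -
  interpret tensor_power "4*n" scaleV ipV scaleW ipW tens by fact
  show ?thesis
  proof unfold_locales
    show "finite (Gamma (4*n) k)" by (simp add: Gamma_def finite_PiE)
    show "l > 0" by (rule l_pos)
    show "unity_root l h ^ l = 1" "(unity_root l h)\<^sup>2 \<noteq> 1"
      using assms(3) l_pos by (simp_all add: unity_root_power_eq_1_iff mult.commute)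
    show "c * cnj c \<noteq> 0" using assms(4) by simp
  next
    fix \<alpha> assume "\<alpha> \<in> Gamma (4*n) k"
    then show "\<alpha> \<circ> w \<in> Gamma (4*n) k" by (rule Gamma_w)
    show "((\<lambda>\<alpha>. \<alpha> \<circ> w) ^^ l) \<alpha> = \<alpha>" by (simp only: funpow_precompose w_pow_l comp_id)
  next
    fix \<alpha> \<beta> assume \<alpha>: "\<alpha> \<in> Gamma (4*n) k" and \<beta>: "\<beta> \<in> Gamma (4*n) k"
    have "ipW (tens (\<lambda>u. e (\<alpha> u))) (tens (\<lambda>u. e (\<beta> u))) = (\<Prod>u\<in>{1..4*n}. ipV (e (\<alpha> u)) (e (\<beta> u)))"
      by (rule ip_tens)
    also have "\<dots> = (\<Prod>u\<in>{1..4*n}. if \<alpha> u = \<beta> u then 1 else 0)"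
      using \<alpha> \<beta> on by (intro prod.cong refl) (auto simp: Gamma_def orthonormal_basis_def dest!: PiE_mem)
    also have "\<dots> = (if \<forall>u\<in>{1..4*n}. \<alpha> u = \<beta> u then 1 else 0)"
      by (auto intro!: prod.neutral prod_zero)
    also have "(\<forall>u\<in>{1..4*n}. \<alpha> u = \<beta> u) \<longleftrightarrow> \<alpha> = \<beta>"
      using \<alpha> \<beta> unfolding Gamma_def by (blast intro: PiE_ext)
    finally show "ipW (scaleW c (tens (\<lambda>u. e (\<alpha> u)))) (scaleW c (tens (\<lambda>u. e (\<beta> u)))) =
        (if \<alpha> = \<beta> then c * cnj c else 0)"
      by (simp add: W.ip_scale_left W.ip_scale_right)
  qed
qed

end

theorem theorem7p3:
  fixes scaleV :: "complex \<Rightarrow> 'v::ab_group_add \<Rightarrow> 'v" and ipV :: "'v \<Rightarrow> 'v \<Rightarrow> complex"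
    and scaleW :: "complex \<Rightarrow> 'w::ab_group_add \<Rightarrow> 'w" and ipW :: "'w \<Rightarrow> 'w \<Rightarrow> complex"
    and tens :: "(nat \<Rightarrow> 'v) \<Rightarrow> 'w" and e :: "nat \<Rightarrow> 'v"
    and n k p l t h :: nat and \<phi> :: "(nat \<Rightarrow> nat) \<Rightarrow> complex" and \<Delta> :: "(nat \<Rightarrow> nat) set"
  assumes "tensor_power (4*n) scaleV ipV scaleW ipW tens"
    and "orthonormal_basis scaleV ipV k e"
    and "n \<ge> 2" and "prime p" and "4*n = l * p ^ t" and "\<not> p dvd l"
    and "h \<in> indexPi n p l t" and "even h"
    and "\<phi> = psi_hat p n h"
    and "orbit_representatives (SD n) (Gamma (4*n) k) \<Delta>"
  shows "(k \<ge> 2 \<longrightarrow>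
            (has_o_basis scaleW ipW tens e (p_regular p n) \<phi> (4*n) k
               (symmetry_class scaleW tens e (p_regular p n) \<phi> (4*n) k)
             \<longleftrightarrow> nu2 (2 * of_nat h / of_nat l) < 0)) \<and>
         (\<forall>\<gamma>\<in>\<Delta>. \<forall>\<sigma>\<in>cyclicC n p t.
            sym_tensor scaleW tens e (p_regular p n) \<phi> (\<gamma> \<circ> \<sigma>) \<noteq> 0
            \<longleftrightarrow> of_nat h * t_index n p l t \<gamma> / of_nat l \<in> \<int>)"
proof -
  interpret regular_rotations n p l t by unfold_locales (use assms(3-6) in auto)
  let ?\<omega> = "unity_root l h" and ?T = "\<lambda>\<alpha>. \<alpha> \<circ> w" and ?\<Gamma> = "Gamma (4*n) k"
  let ?c = "psi_hat p n h id / of_nat (card (p_regular p n))"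
  have "?c \<noteq> 0" using card_p_regular_pos by (simp add: psi_hat_id)
  moreover have "\<not> l dvd 2 * h" using assms(7,8) by (rule indexPi_not_dvd)
  ultimately interpret S: cyclic_symmetrization scaleW ipW ?\<Gamma> ?T
      "\<lambda>\<alpha>. scaleW ?c (tens (\<lambda>u. e (\<alpha> u)))" "?c * cnj ?c" l ?\<omega>
    using assms(1,2) by (intro cyclic_symmetrization_tensors)
  let ?F = "sym_tensor scaleW tens e (p_regular p n) \<phi>"
  have F: "?F = S.symm"
  proof
    fix \<alpha>
    show "?F \<alpha> = S.symm \<alpha>"
      unfolding assms(9) sym_tensor_eq[OF S.vector_space_axioms] S.symm_def S.eig_def funpow_precompose
      by (simp only: S.scale_left_distrib sum.distrib)
  qed
  have order: "?\<omega> ^ i = 1 \<longleftrightarrow> l dvd h * i" for i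
    using l_pos by (rule unity_root_power_eq_1_iff)

  have basis: "has_o_basis scaleW ipW tens e (p_regular p n) \<phi> (4*n) k
      (symmetry_class scaleW tens e (p_regular p n) \<phi> (4*n) k) \<longleftrightarrow> nu2 (2 * of_nat h / of_nat l) < 0"
    if k: "k \<ge> 2"
  proof -
    obtain \<delta> where \<delta>: "\<delta> \<in> ?\<Gamma>" "\<And>i. \<delta> \<circ> w ^^ i = \<delta> \<Longrightarrow> l dvd i"
      using exists_free_sequence[OF k] by blast
    then have "S.symm \<delta> \<noteq> 0"
      unfolding S.symm_nonzero_iff_character_trivial[OF \<delta>(1)] order funpow_precompose
      by (blast intro: dvd_mult)
    then have "has_o_basis scaleW ipW tens e (p_regular p n) \<phi> (4*n) k
        (symmetry_class scaleW tens e (p_regular p n) \<phi> (4*n) k) \<longleftrightarrow> (\<exists>c. ?\<omega> ^ (2 * c) = -1)"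
      unfolding has_o_basis_def symmetry_class_def F
      using S.symm_basis_imp_minus_one_power[OF \<delta>(1)] S.orthogonal_basis_of_symm by metis
    then show ?thesis by (simp only: unity_root_even_power_minus_one_iff[OF l_pos])
  qed

  have nonzero: "?F (\<gamma> \<circ> \<sigma>) \<noteq> 0 \<longleftrightarrow> of_nat h * t_index n p l t \<gamma> / of_nat l \<in> \<int>"
    if \<gamma>: "\<gamma> \<in> \<Delta>" and \<sigma>: "\<sigma> \<in> cyclicC n p t" for \<gamma> \<sigma>
  proof -
    have \<gamma>': "\<gamma> \<in> ?\<Gamma>" using \<gamma> assms(10) by (auto simp: orbit_representatives_def)
    let ?N = "card (cyclicC n p t \<inter> stabilizer_seq (SD n) \<gamma>)"
    obtain i where "\<sigma> = w ^^ i" using \<sigma> by (auto simp: cyclicC_eq)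
    then have "?F (\<gamma> \<circ> \<sigma>) \<noteq> 0 \<longleftrightarrow> S.symm \<gamma> \<noteq> 0"
      using S.symm_T_pow_eq_0_iff[OF \<gamma>', of i] by (simp only: F funpow_precompose)
    also have "\<dots> \<longleftrightarrow> ?N dvd h"
      using S.symm_nonzero_iff_card_dvd[OF \<gamma>' order]
      by (simp only: funpow_precompose card_cyclicC_stabilizer)
    also have "\<dots> \<longleftrightarrow> of_nat h / of_nat ?N \<in> (\<int> :: rat set)"
    proof -
      have "0 \<in> {i. i < l \<and> \<gamma> \<circ> w ^^ i = \<gamma>}" using l_pos by simp
      then have "?N > 0" unfolding card_cyclicC_stabilizer card_gt_0_iff by auto
      then show ?thesis
        using of_int_div_of_int_in_Ints_iff[where ?'a = rat, of "int h" "int ?N"] by simp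
    qed
    also have "of_nat h / of_nat ?N = of_nat h * t_index n p l t \<gamma> / of_nat l"
      using l_pos by (simp add: t_index_def)
    finally show ?thesis .
  qed
  from basis nonzero show ?thesis by blast
qed

end
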